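(* Let $P \in \mathfrak{N}_2$. Then $P$ has a 4-crown stack as a retract if and only if at least one of the following holds: (a) there is a retractive up-split $(k,U,s,t)$ of $P$, with $S=s[P(0\to k)\setminus U]$ and $T=t[P(k+1\to h_P)]$, such that $$S(h_S) < T(0) \quad\text{and}\quad \forall\, u\in U\ \exists\, v\in T(0):\ u \not< p \text{ for all } p\in t^{-1}(v);$$ (b) there is a retractive down-split $(k,D,s,t)$ of $P$, with $S=s[P(k\to h_P)\setminus D]$ and $T=t[P(0\to k-1)]$, such that $$T(h_T) < S(0) \quad\text{and}\quad \forall\, d\in D\ \exists\, v\in T(h_T):\ p \not< d \text{ for all } p\in t^{-1}(v).$$
   Context: All posets are finite. For a poset $P$ let $h_P$ be its height (maximal length of a chain, length = cardinality minus 1). The level sets are $P(0)=\min P$ and $P(k+1)=\min\big(P\setminus\bigcup_{i=0}^k P(i)\big)$ for $0\le k<h_P$. Write $P(k,\ell)=P(k)\cup P(\ell)$ and $P(k\to\ell)=\bigcup_{i=k}^{\ell}P(i)$, and identify subsets with induced subposets. For $A,B\subseteq P$, $A<B$ means $a<b$ for all $a\in A,b\in B$. A retraction of $P$ is an idempotent order-preserving map $r:P\to P$; its image $R$ (an induced subposet) is a retract, and we write $r:P\to R$. A 6-crown is a poset $x_0<y_0>x_1<y_1>x_2<y_2>x_0$ with no other comparabilities between distinct points. For antichains $A,B$ of sizes $m,n\in\{2,3\}$, "type $mn$" means isomorphic to the ordinal sum $A\oplus B$ (every point of $A$ below every point of $B$); type $22$ is a 4-crown. Type $3C$ means three pairwise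 disjoint 2-element chains with no further comparabilities. A 4-crown stack is a poset $Q$ of height $h_Q\ge1$ with $Q(i,i+1)$ of type $22$ for all $i\in[0,h_Q-1]$ (equivalently, an ordinal sum of $h_Q+1$ two-element antichains). A section of width three is a poset $P$ of height $h_P\ge1$ with carrier $\{c_{k,j}: k\in[0,h_P], j\in\{0,1,2\}\}$ such that: $c_{0,j}<\dots<c_{h_P,j}$ is a chain for each $j$; $\{c_{k,0},c_{k,1},c_{k,2}\}$ is an antichain for each $k$; $c_{k,i}<c_{\ell,j}$ implies $c_{k,i+1}<c_{\ell,j+1}$ (indices mod 3); and $P(k,k+1)$ is not of type $33$ for all $k\in[0,h_P-1]$. Then $P(k)=\{c_{k,0},c_{k,1},c_{k,2}\}$, and each $P(k,k+1)$ is a 6-crown or of type $3C$. Such a section is nice if for all $x<y$ in $P$ we have $\{z:z>x\}\not\subseteq\{z:z\ge y\}$ and $\{z:z<y\}\not\subseteq\{z:z\le x\}$. For a nice section $P$ of height $\ge2$, its horizon is the smallest $\eta\in\mathbb{N}$ with $P(k)<P(k+\eta)$ for all $k\in[0,h_P-\eta]$. $\mathfrak{N}_2$ denotes the class of nice sections of width three with height $\ge2$ and horizon $2$ (so $P(k)<P(\ell)$ whenever $\ell\ge k+2$, and $P(k,k+1)$ is a 6-crown or of type $3C$). Let $P\in\mathfrak N_2$. A retractive up-split of $P$ is a quadruple $(k,U,s,t)$ with $k\in[0,h_P-1]$, $U\subset P(0\to k)$, $s:P(0\to k)\setminus U\to S$ a retraction, and $t:P(k+1\to h_P)\to T$ a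 retraction, where $S$ and $T$ are each a 2-element antichain or a 4-crown stack. A retractive down-split of $P$ is a quadruple $(k,D,s,t)$ with $k\in[1,h_P]$, $D\subset P(k\to h_P)$, $s:P(k\to h_P)\setminus D\to S$ a retraction, and $t:P(0\to k-1)\to T$ a retraction, where $S,T$ are each a 2-element antichain or a 4-crown stack. Level indices $S(\cdot),T(\cdot)$ refer to the level sets of $S,T$ themselves. *)

theory Defs
  imports Main
begin

text \<open>A finite poset is given by a carrier set A and a relation le (the order),
  subsets are identified with induced subposets (same relation restricted).\<close>

definition poset_on :: "'a set \<Rightarrow> ('a \<Rightarrow> 'a \<Rightarrow> bool) \<Rightarrow> bool" where
  "poset_on A le \<longleftrightarrow> finite A \<and> (\<forall>x\<in>A. le x x)
     \<and> (\<forall>x\<in>A. \<forall>y\<in>A. le x y \<and> le y x \<longrightarrow> x = y)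
     \<and> (\<forall>x\<in>A. \<forall>y\<in>A. \<forall>z\<in>A. le x y \<and> le y z \<longrightarrow> le x z)"

definition lt :: "('a \<Rightarrow> 'a \<Rightarrow> bool) \<Rightarrow> 'a \<Rightarrow> 'a \<Rightarrow> bool" where
  "lt le x y \<longleftrightarrow> le x y \<and> x \<noteq> y"

definition set_lt :: "('a \<Rightarrow> 'a \<Rightarrow> bool) \<Rightarrow> 'a set \<Rightarrow> 'a set \<Rightarrow> bool" where
  "set_lt le X Y \<longleftrightarrow> (\<forall>x\<in>X. \<forall>y\<in>Y. lt le x y)"

definition is_chain :: "('a \<Rightarrow> 'a \<Rightarrow> bool) \<Rightarrow> 'a set \<Rightarrow> bool" where
  "is_chain le C \<longleftrightarrow> (\<forall>x\<in>C. \<forall>y\<in>C. le x y \<or> le y x)"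

definition is_antichain :: "('a \<Rightarrow> 'a \<Rightarrow> bool) \<Rightarrow> 'a set \<Rightarrow> bool" where
  "is_antichain le C \<longleftrightarrow> (\<forall>x\<in>C. \<forall>y\<in>C. le x y \<longrightarrow> x = y)"

definition height :: "'a set \<Rightarrow> ('a \<Rightarrow> 'a \<Rightarrow> bool) \<Rightarrow> nat" where
  "height A le = Max {card C - 1 | C. C \<subseteq> A \<and> C \<noteq> {} \<and> is_chain le C}"

definition minimals :: "('a \<Rightarrow> 'a \<Rightarrow> bool) \<Rightarrow> 'a set \<Rightarrow> 'a set" where
  "minimals le X = {x\<in>X. \<not> (\<exists>y\<in>X. lt le y x)}"

primrec rest :: "'a set \<Rightarrow> ('a \<Rightarrow> 'a \<Rightarrow> bool) \<Rightarrow> nat \<Rightarrow> 'a set" where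
  "rest A le 0 = A"
| "rest A le (Suc k) = rest A le k - minimals le (rest A le k)"

definition level :: "'a set \<Rightarrow> ('a \<Rightarrow> 'a \<Rightarrow> bool) \<Rightarrow> nat \<Rightarrow> 'a set" where
  "level A le k = minimals le (rest A le k)"

definition levels :: "'a set \<Rightarrow> ('a \<Rightarrow> 'a \<Rightarrow> bool) \<Rightarrow> nat \<Rightarrow> nat \<Rightarrow> 'a set" where
  "levels A le k l = (\<Union>i\<in>{k..l}. level A le i)"

definition type22 :: "('a \<Rightarrow> 'a \<Rightarrow> bool) \<Rightarrow> 'a set \<Rightarrow> bool" where
  "type22 le X \<longleftrightarrow> (\<exists>a1 a2 b1 b2. distinct [a1,a2,b1,b2] \<and> X = {a1,a2,b1,b2}
      \<and> is_antichain le {a1,a2} \<and> is_antichain le {b1,b2}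
      \<and> set_lt le {a1,a2} {b1,b2})"

definition type33 :: "('a \<Rightarrow> 'a \<Rightarrow> bool) \<Rightarrow> 'a set \<Rightarrow> bool" where
  "type33 le X \<longleftrightarrow> (\<exists>a1 a2 a3 b1 b2 b3. distinct [a1,a2,a3,b1,b2,b3]
      \<and> X = {a1,a2,a3,b1,b2,b3}
      \<and> is_antichain le {a1,a2,a3} \<and> is_antichain le {b1,b2,b3}
      \<and> set_lt le {a1,a2,a3} {b1,b2,b3})"

definition crown4_stack :: "'a set \<Rightarrow> ('a \<Rightarrow> 'a \<Rightarrow> bool) \<Rightarrow> bool" where
  "crown4_stack Q le \<longleftrightarrow> height Q le \<ge> 1
     \<and> (\<forall>i < height Q le. type22 le (level Q le i \<union> level Q le (Suc i)))"

definition antichain2 :: "'a set \<Rightarrow> ('a \<Rightarrow> 'a \<Rightarrow> bool) \<Rightarrow> bool" where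
  "antichain2 Q le \<longleftrightarrow> card Q = 2 \<and> is_antichain le Q"

definition retraction_on :: "'a set \<Rightarrow> ('a \<Rightarrow> 'a \<Rightarrow> bool) \<Rightarrow> ('a \<Rightarrow> 'a) \<Rightarrow> bool" where
  "retraction_on B le r \<longleftrightarrow> (\<forall>x\<in>B. r x \<in> B) \<and> (\<forall>x\<in>B. r (r x) = r x)
     \<and> (\<forall>x\<in>B. \<forall>y\<in>B. le x y \<longrightarrow> le (r x) (r y))"

definition section_w3 :: "'a set \<Rightarrow> ('a \<Rightarrow> 'a \<Rightarrow> bool) \<Rightarrow> bool" where
  "section_w3 A le \<longleftrightarrow> height A le \<ge> 1 \<and>
    (\<exists>c :: nat \<Rightarrow> nat \<Rightarrow> 'a.
       inj_on (\<lambda>(k,j). c k j) ({0..height A le} \<times> {0..<3})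
     \<and> A = (\<lambda>(k,j). c k j) ` ({0..height A le} \<times> {0..<3})
     \<and> (\<forall>j<3. \<forall>k<height A le. lt le (c k j) (c (Suc k) j))
     \<and> (\<forall>k\<le>height A le. is_antichain le {c k 0, c k 1, c k 2})
     \<and> (\<forall>k\<le>height A le. \<forall>l\<le>height A le. \<forall>i<3. \<forall>j<3.
          lt le (c k i) (c l j) \<longrightarrow> lt le (c k ((i+1) mod 3)) (c l ((j+1) mod 3)))
     \<and> (\<forall>k<height A le. \<not> type33 le (level A le k \<union> level A le (Suc k))))"

definition nice :: "'a set \<Rightarrow> ('a \<Rightarrow> 'a \<Rightarrow> bool) \<Rightarrow> bool" where
  "nice A le \<longleftrightarrow> (\<forall>x\<in>A. \<forall>y\<in>A. lt le x y \<longrightarrow>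
       \<not> ({z\<in>A. lt le x z} \<subseteq> {z\<in>A. le y z}) \<and> \<not> ({z\<in>A. lt le z y} \<subseteq> {z\<in>A. le z x}))"

definition horizon :: "'a set \<Rightarrow> ('a \<Rightarrow> 'a \<Rightarrow> bool) \<Rightarrow> nat" where
  "horizon A le = (LEAST \<eta>. \<forall>k. k + \<eta> \<le> height A le \<longrightarrow>
       set_lt le (level A le k) (level A le (k + \<eta>)))"

definition N2 :: "'a set \<Rightarrow> ('a \<Rightarrow> 'a \<Rightarrow> bool) \<Rightarrow> bool" where
  "N2 A le \<longleftrightarrow> poset_on A le \<and> section_w3 A le \<and> nice A le
     \<and> height A le \<ge> 2 \<and> horizon A le = 2"

definition has_crown_stack_retract :: "'a set \<Rightarrow> ('a \<Rightarrow> 'a \<Rightarrow> bool) \<Rightarrow> bool" where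
  "has_crown_stack_retract A le \<longleftrightarrow>
     (\<exists>r. retraction_on A le r \<and> crown4_stack (r ` A) le)"

definition good_target :: "'a set \<Rightarrow> ('a \<Rightarrow> 'a \<Rightarrow> bool) \<Rightarrow> bool" where
  "good_target Q le \<longleftrightarrow> antichain2 Q le \<or> crown4_stack Q le"

definition retractive_up_split ::
  "'a set \<Rightarrow> ('a \<Rightarrow> 'a \<Rightarrow> bool) \<Rightarrow> nat \<Rightarrow> 'a set \<Rightarrow> ('a \<Rightarrow> 'a) \<Rightarrow> ('a \<Rightarrow> 'a) \<Rightarrow> bool" where
  "retractive_up_split A le k U s t \<longleftrightarrow>
     k < height A le \<and> U \<subset> levels A le 0 k
     \<and> retraction_on (levels A le 0 k - U) le s
     \<and> good_target (s ` (levels A le 0 k - U)) le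
     \<and> retraction_on (levels A le (Suc k) (height A le)) le t
     \<and> good_target (t ` levels A le (Suc k) (height A le)) le"

definition retractive_down_split ::
  "'a set \<Rightarrow> ('a \<Rightarrow> 'a \<Rightarrow> bool) \<Rightarrow> nat \<Rightarrow> 'a set \<Rightarrow> ('a \<Rightarrow> 'a) \<Rightarrow> ('a \<Rightarrow> 'a) \<Rightarrow> bool" where
  "retractive_down_split A le k D s t \<longleftrightarrow>
     1 \<le> k \<and> k \<le> height A le \<and> D \<subset> levels A le k (height A le)
     \<and> retraction_on (levels A le k (height A le) - D) le s
     \<and> good_target (s ` (levels A le k (height A le) - D)) le
     \<and> retraction_on (levels A le 0 (k - 1)) le t
     \<and> good_target (t ` levels A le 0 (k - 1)) le"

end

theory Submission
  imports Defs
begin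

text \<open>
  Let a retraction \<open>r\<close> map onto the stack \<open>R\<^sub>0 < \<dots> < R\<^sub>m\<close>. It suffices to cut directly below the
  top antichain \<open>R\<^sub>m = {u, v}\<close>, where \<open>lev u \<le> lev v\<close> and \<open>lev u = k + 1\<close>: restricting \<open>r\<close> gives an
  up-split at \<open>k\<close> if \<open>r\<close> maps all levels above \<open>k\<close> into \<open>R\<^sub>m\<close>, and a down-split at \<open>k + 1\<close> if it
  maps no point of level at most \<open>k\<close> into \<open>R\<^sub>m\<close>.
  If \<open>v\<close> lies on level \<open>k + 2\<close>, the second case occurs: a bad point \<open>y\<close> is on level \<open>k\<close>, is mapped
  to \<open>v\<close>, and has an upper cover \<open>y'\<close>, also mapped to \<open>v\<close>; a common upper bound of \<open>u\<close> and \<open>y'\<close>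
  would be mapped above both \<open>u\<close> and \<open>v\<close>.
  If \<open>u\<close> and \<open>v\<close> are on the same level and both cases fail, witnessed by \<open>x\<close> on level \<open>k + 1\<close> and
  \<open>y\<close> on level \<open>k\<close>, then some \<open>p \<in> R\<^bsub>m-1\<^esub>\<close> on level \<open>k\<close> lies below \<open>u\<close> and \<open>v\<close>, so the two levels
  form a 6-crown, in which only \<open>p\<close> is not below \<open>x\<close>; but neither is \<open>y\<close>.

  Conversely, horizon 2 forces \<open>U\<close> into level \<open>k\<close>, hence \<open>U\<close> consists of maximal points of the lower
  part, and \<open>s\<close> and \<open>t\<close> are glued by sending each \<open>u \<in> U\<close> to the point of \<open>T(0)\<close> other than its \<open>v\<close>.
  Down-splits are order-dual.
\<close>

section \<open>Four-crown stacks\<close>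

text \<open>The two points of the \<open>i\<close>-th antichain are \<open>a i True\<close> and \<open>a i False\<close>; two-element antichains
  are included as the case \<open>m = 0\<close>.\<close>
definition stack_rep :: "('a \<Rightarrow> 'a \<Rightarrow> bool) \<Rightarrow> 'a set \<Rightarrow> nat \<Rightarrow> (nat \<Rightarrow> bool \<Rightarrow> 'a) \<Rightarrow> bool" where
  "stack_rep le Q m a \<longleftrightarrow> Q = {a i b | i b. i \<le> m}
     \<and> (\<forall>i\<le>m. \<forall>j\<le>m. \<forall>b c. le (a i b) (a j c) \<longleftrightarrow> i < j \<or> (i = j \<and> b = c))"

section \<open>Order, levels and height of a stack in coordinates\<close>

lemma stack_rep_le:
  "stack_rep le Q m a \<Longrightarrow> i \<le> m \<Longrightarrow> j \<le> m \<Longrightarrow> le (a i b) (a j c) \<longleftrightarrow> i < j \<or> (i = j \<and> b = c)"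
  unfolding stack_rep_def by simp

lemma stack_rep_mem: "stack_rep le Q m a \<Longrightarrow> i \<le> m \<Longrightarrow> a i b \<in> Q"
  unfolding stack_rep_def by blast

lemma stack_rep_cases:
  assumes "stack_rep le Q m a" "x \<in> Q"
  obtains i b where "i \<le> m" "x = a i b"
  using assms unfolding stack_rep_def by blast

lemma stack_rep_eq_iff:
  assumes "stack_rep le Q m a" "i \<le> m" "j \<le> m"
  shows "a i b = a j c \<longleftrightarrow> i = j \<and> b = c"
proof
  assume eq: "a i b = a j c"
  have "le (a i b) (a i b)" using stack_rep_le[OF assms(1,2,2)] by simp
  then have "le (a i b) (a j c)" "le (a j c) (a i b)" using eq by simp_all
  then show "i = j \<and> b = c"
    using stack_rep_le[OF assms] stack_rep_le[OF assms(1,3,2)] by auto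
qed simp

lemma stack_rep_lt:
  assumes "stack_rep le Q m a" "i \<le> m" "j \<le> m"
  shows "lt le (a i b) (a j c) \<longleftrightarrow> i < j"
  using stack_rep_le[OF assms] stack_rep_eq_iff[OF assms] unfolding lt_def by auto

lemma stack_rep_rest:
  assumes "stack_rep le Q m a"
  shows "rest Q le k = {a i b | i b. k \<le> i \<and> i \<le> m}"
    and "k \<le> m \<Longrightarrow> level Q le k = {a k True, a k False}"
proof -
  \<comment> \<open>Keeping the condition \<open>k <= m\<close> on the right makes the equation hold
    for \<open>k\<close> beyond the top as well, where both sides are empty; the induction for
    \<open>rest\<close> runs over all \<open>k\<close>.\<close>
  have mins: "minimals le {a i b | i b. k \<le> i \<and> i \<le> m} = {a k b | b. k \<le> m}" for k
  proof
    show "minimals le {a i b | i b. k \<le> i \<and> i \<le> m} \<subseteq> {a k b | b. k \<le> m}"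
    proof
      fix x assume x: "x \<in> minimals le {a i b | i b. k \<le> i \<and> i \<le> m}"
      then obtain i b where ib: "x = a i b" "k \<le> i" "i \<le> m" unfolding minimals_def by blast
      have "\<not> lt le (a k b) (a i b)"
        using x ib unfolding minimals_def by (auto dest: order_trans)
      then have "\<not> k < i" using stack_rep_lt[OF assms] ib by auto
      then show "x \<in> {a k b | b. k \<le> m}" using ib by auto
    qed
    show "{a k b | b. k \<le> m} \<subseteq> minimals le {a i b | i b. k \<le> i \<and> i \<le> m}"
      unfolding minimals_def using stack_rep_lt[OF assms] by fastforce
  qed
  show rest: "rest Q le k = {a i b | i b. k \<le> i \<and> i \<le> m}" for k
  proof (induction k)
    case 0
    then show ?case using assms unfolding stack_rep_def by simp
  next
    case (Suc k)
    have "{a i b | i b. k \<le> i \<and> i \<le> m} - {a k b | b. k \<le> m} = {a i b | i b. Suc k \<le> i \<and> i \<le> m}"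
    proof (intro set_eqI iffI)
      fix x assume "x \<in> {a i b | i b. k \<le> i \<and> i \<le> m} - {a k b | b. k \<le> m}"
      then show "x \<in> {a i b | i b. Suc k \<le> i \<and> i \<le> m}"
        by (auto simp: Suc_le_eq) (metis le_neq_implies_less)
    next
      fix x assume "x \<in> {a i b | i b. Suc k \<le> i \<and> i \<le> m}"
      then obtain i b where ib: "x = a i b" "Suc k \<le> i" "i \<le> m" by blast
      then have "x \<noteq> a k c" for c using stack_rep_eq_iff[OF assms, of i k] by simp
      moreover have "k \<le> i" using ib(2) by simp
      ultimately show "x \<in> {a i b | i b. k \<le> i \<and> i \<le> m} - {a k b | b. k \<le> m}"
        using ib(1,3) by blast
    qed
    then show ?case using Suc mins by simp
  qed
  show "level Q le k = {a k True, a k False}" if "k \<le> m"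
  proof -
    have "level Q le k = range (a k)" unfolding level_def rest mins using that by auto
    then show ?thesis by (simp add: UNIV_bool insert_commute)
  qed
qed

lemma finite_chain_cards:
  assumes "finite Q"
  shows "finite {card C - 1 |C. C \<subseteq> Q \<and> C \<noteq> {} \<and> is_chain le C}"
proof (rule finite_subset)
  show "{card C - 1 |C. C \<subseteq> Q \<and> C \<noteq> {} \<and> is_chain le C} \<subseteq> (\<lambda>C. card C - 1) ` Pow Q" by blast
  show "finite ((\<lambda>C. card C - 1) ` Pow Q)" using assms by simp
qed

text \<open>A chain meets each antichain of the stack at most once, so it has at most
  \<open>m + 1\<close> points; the points \<open>a i True\<close> attain this bound.\<close>

lemma stack_rep_height:
  assumes "stack_rep le Q m a"
  shows "height Q le = m"
  unfolding height_def
proof (rule Max_eqI)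
  have Q: "Q = (\<lambda>(i,b). a i b) ` ({..m} \<times> UNIV)" using assms unfolding stack_rep_def by force
  then have "finite Q" by simp
  then show "finite {card C - 1 |C. C \<subseteq> Q \<and> C \<noteq> {} \<and> is_chain le C}" by (rule finite_chain_cards)
next
  fix y assume "y \<in> {card C - 1 |C. C \<subseteq> Q \<and> C \<noteq> {} \<and> is_chain le C}"
  then obtain C where C: "y = card C - 1" "C \<subseteq> Q" "is_chain le C" by blast
  have "\<forall>x\<in>C. \<exists>i b. i \<le> m \<and> x = a i b" using C(2) assms unfolding stack_rep_def by blast
  then obtain f g where fg: "\<And>x. x \<in> C \<Longrightarrow> f x \<le> m \<and> x = a (f x) (g x)" by metis
  have "inj_on f C"
  proof (rule inj_onI)
    fix x y assume xy: "x \<in> C" "y \<in> C" "f x = f y"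
    have "x = a (f x) (g x)" "f x \<le> m" using fg[OF xy(1)] by blast+
    moreover have "y = a (f x) (g y)" unfolding xy(3) using fg[OF xy(2)] by blast
    ultimately obtain i b c where ibc: "x = a i b" "y = a i c" "i \<le> m" by blast
    have "le x y \<or> le y x" using C(3) xy unfolding is_chain_def by blast
    then show "x = y" using stack_rep_le[OF assms ibc(3,3)] unfolding ibc by auto
  qed
  moreover have "f ` C \<subseteq> {..m}" using fg by blast
  ultimately have "card C \<le> card {..m}" using card_inj_on_le by blast
  then show "y \<le> m" using C by simp
next
  define C where "C = (\<lambda>i. a i True) ` {..m}"
  have "inj_on (\<lambda>i. a i True) {..m}"
    using stack_rep_eq_iff[OF assms] unfolding inj_on_def by simp
  then have "card C = Suc m" unfolding C_def by (simp add: card_image)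
  moreover have "is_chain le C"
    unfolding is_chain_def C_def using stack_rep_le[OF assms] by (auto simp: nat_neq_iff)
  moreover have "C \<subseteq> Q" unfolding C_def using stack_rep_mem[OF assms] by auto
  moreover have "C \<noteq> {}" unfolding C_def by simp
  ultimately show "m \<in> {card C - 1 |C. C \<subseteq> Q \<and> C \<noteq> {} \<and> is_chain le C}"
    by (intro CollectI exI[of _ C]) simp
qed

lemma stack_rep_crown4_stack:
  assumes "stack_rep le Q m a" "m \<ge> 1"
  shows "crown4_stack Q le"
  unfolding crown4_stack_def stack_rep_height[OF assms(1)]
proof (intro conjI allI impI)
  fix i assume i: "i < m"
  let ?a = "a i True" and ?b = "a i False" and ?c = "a (Suc i) True" and ?d = "a (Suc i) False"
  have i': "i \<le> m" "Suc i \<le> m" using i by auto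
  have "level Q le i \<union> level Q le (Suc i) = {?a, ?b, ?c, ?d}"
    using stack_rep_rest(2)[OF assms(1)] i' by auto
  moreover have "distinct [?a, ?b, ?c, ?d]"
    using stack_rep_eq_iff[OF assms(1)] i' by simp
  moreover have "is_antichain le {?a, ?b}" "is_antichain le {?c, ?d}"
    unfolding is_antichain_def using stack_rep_le[OF assms(1)] i' by simp_all
  moreover have "set_lt le {?a, ?b} {?c, ?d}"
    unfolding set_lt_def using stack_rep_lt[OF assms(1)] i' by simp
  ultimately show "type22 le (level Q le i \<union> level Q le (Suc i))"
    unfolding type22_def
    by (intro exI[of _ ?a] exI[of _ ?b] exI[of _ ?c] exI[of _ ?d] conjI)
next
  show "1 \<le> m" by (fact assms(2))
qed

lemma stack_rep_good_target:
  assumes "stack_rep le Q m a"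
  shows "good_target Q le"
proof (cases "m = 0")
  case True
  then have "Q = {a i b |i b. i \<le> 0}" using assms unfolding stack_rep_def by simp
  then have "Q = range (a 0)" by auto
  then have "Q = {a 0 True, a 0 False}" by (simp add: UNIV_bool insert_commute)
  moreover have "a 0 True \<noteq> a 0 False" using stack_rep_eq_iff[OF assms] by blast
  ultimately have "antichain2 Q le"
    using stack_rep_le[OF assms, of 0 0] unfolding antichain2_def is_antichain_def by simp
  then show ?thesis unfolding good_target_def by blast
next
  case False
  then have "m \<ge> 1" by simp
  then show ?thesis using stack_rep_crown4_stack[OF assms] unfolding good_target_def by blast
qed

section \<open>Level sets and chains of a finite poset\<close>

lemma rest_antimono: "i \<le> j \<Longrightarrow> rest Q le j \<subseteq> rest Q le i"
  by (induction j rule: dec_induct) auto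

text \<open>Since \<open>y\<close> survives the removal of level \<open>i\<close>, something in
  \<open>rest Q le i\<close> lies below it; since \<open>y\<close> is minimal afterwards, that point
  was itself removed, so it is on level \<open>i\<close>.\<close>

lemma level_Suc_below:
  assumes "y \<in> level Q le (Suc i)"
  shows "\<exists>x\<in>level Q le i. lt le x y"
proof -
  have y: "y \<in> rest Q le i" "y \<notin> minimals le (rest Q le i)"
    "\<forall>z\<in>rest Q le i - minimals le (rest Q le i). \<not> lt le z y"
    using assms unfolding level_def by (simp_all add: minimals_def)
  then obtain x where "x \<in> rest Q le i" "lt le x y" unfolding minimals_def by blast
  then show ?thesis using y(3) unfolding level_def by blast
qed

text \<open>An element with the fewest points strictly below it is minimal: by transitivity anything
  smaller would have strictly fewer.\<close>

lemma poset_minimals_nonempty: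
  assumes "poset_on Q le" "X \<subseteq> Q" "X \<noteq> {}"
  shows "minimals le X \<noteq> {}"
proof -
  let ?f = "\<lambda>x. card {z\<in>X. lt le z x}"
  have finX: "finite X" using assms unfolding poset_on_def by (meson finite_subset)
  obtain x where x: "x \<in> X" "\<And>y. y \<in> X \<Longrightarrow> ?f x \<le> ?f y"
    using assms(3) ex_has_least_nat[of "\<lambda>x. x \<in> X" _ ?f] by blast
  have "\<not> lt le y x" if y: "y \<in> X" for y
  proof
    assume yx: "lt le y x"
    have "{z\<in>X. lt le z y} \<subset> {z\<in>X. lt le z x}"
      using assms(1,2) x(1) y yx unfolding poset_on_def lt_def by blast
    then have "?f y < ?f x" using finX by (simp add: psubset_card_mono)
    then show False using x(2)[OF y] by simp
  qed
  then show ?thesis using x(1) unfolding minimals_def by blast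
qed

text \<open>Bounds level indices by chain sizes, hence by \<open>height\<close>. The clause that
  \<open>x\<close> is the greatest element of the chain is what allows the induction to add a new
  point on top.\<close>

lemma level_chain_below:
  assumes "poset_on Q le" "x \<in> level Q le i"
  shows "\<exists>C\<subseteq>Q. is_chain le C \<and> card C = Suc i \<and> x \<in> C \<and> (\<forall>z\<in>C. le z x)"
  using assms(2)
proof (induction i arbitrary: x)
  case 0
  then have "x \<in> Q" unfolding level_def minimals_def by simp
  then show ?case using assms(1) unfolding is_chain_def poset_on_def
    by (intro exI[of _ "{x}"]) auto
next
  case (Suc i)
  have xQ: "x \<in> Q" using Suc.prems rest_antimono[of 0 "Suc i" Q le] unfolding level_def minimals_def
    by auto
  obtain y where y: "y \<in> level Q le i" "lt le y x" using level_Suc_below[OF Suc.prems] by blast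
  obtain C where C: "C \<subseteq> Q" "is_chain le C" "card C = Suc i" "y \<in> C" "\<forall>z\<in>C. le z y"
    using Suc.IH[OF y(1)] by blast
  have yQ: "y \<in> Q" and yx: "le y x" "y \<noteq> x" using C y(2) unfolding lt_def by auto
  have zx: "le z x" if "z \<in> C" for z
  proof -
    have "z \<in> Q" "le z y" using C that by auto
    then show ?thesis using assms(1) yQ yx xQ unfolding poset_on_def by blast
  qed
  have "x \<notin> C"
  proof
    assume "x \<in> C"
    then have "le x y" using C by blast
    then show False using assms(1) yQ yx xQ unfolding poset_on_def by blast
  qed
  moreover have "finite C" using C(3) card.infinite by fastforce
  ultimately have "card (insert x C) = Suc (Suc i)" using C(3) by simp
  moreover have "le x x" using xQ assms(1) unfolding poset_on_def by blast
  moreover from this have "is_chain le (insert x C)"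
    using zx C(2) unfolding is_chain_def by blast
  moreover have "insert x C \<subseteq> Q" using C(1) xQ by blast
  ultimately show ?case using zx by (intro exI[of _ "insert x C"]) simp
qed

lemma chain_card_le_height:
  assumes "poset_on Q le" "C \<subseteq> Q" "C \<noteq> {}" "is_chain le C"
  shows "card C - 1 \<le> height Q le"
  unfolding height_def
proof (rule Max_ge)
  have "finite Q" using assms(1) unfolding poset_on_def by blast
  then show "finite {card C - 1 |C. C \<subseteq> Q \<and> C \<noteq> {} \<and> is_chain le C}" by (rule finite_chain_cards)
  show "card C - 1 \<in> {card C - 1 |C. C \<subseteq> Q \<and> C \<noteq> {} \<and> is_chain le C}"
    using assms by (intro CollectI exI[of _ C]) simp
qed

text \<open>A point on the level after \<open>height Q le\<close> would be the top of a chain longer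
  than the height permits. So that level is empty, and as a nonempty subset always has minimal
  points, nothing is left over.\<close>

lemma poset_level_cover:
  assumes "poset_on Q le"
  shows "Q = (\<Union>i\<le>height Q le. level Q le i)"
proof
  have sub: "rest Q le i \<subseteq> Q" for i using rest_antimono[of 0 i Q le] by simp
  then show "(\<Union>i\<le>height Q le. level Q le i) \<subseteq> Q" unfolding level_def minimals_def by blast
  have "level Q le (Suc (height Q le)) = {}"
  proof (rule ccontr)
    assume "level Q le (Suc (height Q le)) \<noteq> {}"
    then obtain x where "x \<in> level Q le (Suc (height Q le))" by blast
    then obtain C where "C \<subseteq> Q" "is_chain le C" "card C = Suc (Suc (height Q le))" "x \<in> C"
      using level_chain_below[OF assms] by meson
    then show False using chain_card_le_height[OF assms, of C] by auto
  qed
  then have emp: "rest Q le (Suc (height Q le)) = {}"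
    using poset_minimals_nonempty[OF assms sub] unfolding level_def by blast
  have "Q \<subseteq> rest Q le j \<union> (\<Union>i<j. level Q le i)" for j
    by (induction j) (auto simp: level_def lessThan_Suc)
  from this[of "Suc (height Q le)"] show "Q \<subseteq> (\<Union>i\<le>height Q le. level Q le i)"
    by (simp only: emp lessThan_Suc_atMost Un_empty_left)
qed

text \<open>\<open>crown4_stack\<close> compares only consecutive levels. Transitivity extends this
  to all pairs of levels, and by \<open>poset_level_cover\<close> the levels exhaust
  \<open>Q\<close>, so the coordinates capture the entire order.\<close>

lemma crown4_stack_rep:
  assumes po: "poset_on Q le" and cs: "crown4_stack Q le"
  obtains m a where "m \<ge> 1" "stack_rep le Q m a"
proof -
  define h where "h = height Q le"
  let ?L = "level Q le"
  have h1: "h \<ge> 1" using cs unfolding crown4_stack_def h_def by blast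
  have LQ: "?L i \<subseteq> Q" for i
    using rest_antimono[of 0 i Q le] unfolding level_def minimals_def by auto
  have anti: "\<not> lt le x y" if "x \<in> ?L i" "y \<in> ?L i" for x y i
    using that unfolding level_def minimals_def by blast
  have adj: "(\<exists>x y. x \<noteq> y \<and> ?L i = {x,y}) \<and> (\<exists>x y. x \<noteq> y \<and> ?L (Suc i) = {x,y})
      \<and> set_lt le (?L i) (?L (Suc i))" if i: "i < h" for i
  proof -
    obtain a1 a2 b1 b2 where ab: "distinct [a1,a2,b1,b2]"
      "?L i \<union> ?L (Suc i) = {a1,a2,b1,b2}" "is_antichain le {a1,a2}" "set_lt le {a1,a2} {b1,b2}"
      using cs i unfolding crown4_stack_def type22_def h_def by blast
    have inQ: "{a1,a2,b1,b2} \<subseteq> Q" using ab(2) LQ by blast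
    have nb: "\<not> lt le x y" if xy: "y \<in> {a1,a2}" "x \<in> {a1,a2,b1,b2}" for x y
    proof (cases "x \<in> {a1,a2}")
      case True
      then show ?thesis using ab(3) xy(1) unfolding is_antichain_def lt_def by blast
    next
      case False
      then have "x \<in> {b1,b2}" using xy(2) by blast
      then have "lt le y x" using ab(4) xy(1) unfolding set_lt_def by blast
      moreover have "x \<in> Q" "y \<in> Q" using xy inQ by blast+
      ultimately show ?thesis using po unfolding lt_def poset_on_def by blast
    qed
    \<comment> \<open>\<open>type22\<close> does not say which pair is which level. A point of level
      \<open>Suc i\<close> has a point of level \<open>i\<close> below it, but by \<open>nb\<close>
      nothing in the union is below \<open>a1\<close> or \<open>a2\<close>. Conversely,
      \<open>b1\<close> and \<open>b2\<close> lie above points of level \<open>i\<close>, which is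
      an antichain.\<close>
    have a: "{a1,a2} \<inter> ?L (Suc i) = {}"
      using level_Suc_below[of _ Q le i] nb ab(2) by blast
    then have aL: "{a1,a2} \<subseteq> ?L i" using ab(2) by blast
    have "{b1,b2} \<inter> ?L i = {}" using anti aL ab(4) unfolding set_lt_def by blast
    then have "?L i = {a1,a2}" "?L (Suc i) = {b1,b2}" using ab(2) a aL by blast+
    then show ?thesis using ab(1,4) by auto
  qed
  \<comment> \<open>\<open>adj\<close> is available only below \<open>h\<close>, so the top level is
    read off as the upper one of the pair at \<open>h - 1\<close>.\<close>
  have "\<exists>x y. x \<noteq> y \<and> ?L i = {x,y}" if "i \<le> h" for i
    using adj[of i] adj[of "i - 1"] that h1 by (cases "i = h") auto
  then obtain f g where fg: "\<And>i. i \<le> h \<Longrightarrow> f i \<noteq> g i \<and> ?L i = {f i, g i}" by metis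
  define a where "a i b = (if b then f i else g i)" for i :: nat and b :: bool
  have aL: "a i b \<in> ?L i" if "i \<le> h" for i b using fg[OF that] unfolding a_def by auto
  have aQ: "a i b \<in> Q" if "i \<le> h" for i b using aL[OF that] LQ by blast
  have step: "lt le (a i b) (a (Suc i) c)" if "i < h" for i b c
    using adj[OF that] aL[of i b] aL[of "Suc i" c] that unfolding set_lt_def by auto
  have up: "lt le (a i b) (a j c)" if "i < j" "j \<le> h" for i j b c
    using that
  proof (induction j arbitrary: c)
    case (Suc j)
    show ?case
    proof (cases "i = j")
      case True
      then show ?thesis using step Suc.prems by auto
    next
      case False
      then have "lt le (a i b) (a j True)" "lt le (a j True) (a (Suc j) c)"
        using Suc step by auto
      moreover have "a i b \<in> Q" "a j True \<in> Q" "a (Suc j) c \<in> Q" using aQ Suc.prems by auto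
      ultimately show ?thesis using po unfolding lt_def poset_on_def by metis
    qed
  qed simp
  have same: "le (a i b) (a i c) \<longleftrightarrow> b = c" if "i \<le> h" for i b c
  proof -
    have "le (a i b) (a i b)" using aQ[OF that] po unfolding poset_on_def by blast
    moreover have "b \<noteq> c \<Longrightarrow> a i b \<noteq> a i c" using fg[OF that] unfolding a_def by auto
    ultimately show ?thesis using anti[OF aL aL, OF that that, of b c] unfolding lt_def by blast
  qed
  have iff: "le (a i b) (a j c) \<longleftrightarrow> i < j \<or> (i = j \<and> b = c)" if ij: "i \<le> h" "j \<le> h" for i j b c
  proof (cases i j rule: linorder_cases)
    case less
    then show ?thesis using up ij unfolding lt_def by blast
  next
    case equal
    then show ?thesis using same ij by auto
  next
    case greater
    then have "lt le (a j c) (a i b)" using up ij by blast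
    then have "\<not> le (a i b) (a j c)" using po aQ ij unfolding lt_def poset_on_def by blast
    then show ?thesis using greater by auto
  qed
  have Q: "Q = {a i b |i b. i \<le> h}"
  proof
    have "?L i \<subseteq> {a i True, a i False}" if "i \<le> h" for i using fg[OF that] unfolding a_def by auto
    then show "Q \<subseteq> {a i b |i b. i \<le> h}"
      using poset_level_cover[OF po] unfolding h_def by blast
  qed (use aQ in blast)
  have "stack_rep le Q h a" unfolding stack_rep_def by (intro conjI allI impI Q iff)
  then show thesis using that h1 by blast
qed

lemma good_target_rep:
  assumes po: "poset_on Q le" and gt: "good_target Q le"
  obtains m a where "stack_rep le Q m a"
proof (cases "crown4_stack Q le")
  case True
  then show ?thesis using crown4_stack_rep[OF po] that by blast
next
  case False
  then have "card Q = 2" and anti: "is_antichain le Q"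
    using gt unfolding good_target_def antichain2_def by auto
  then obtain x y where xy: "Q = {x,y}" "x \<noteq> y" by (auto simp: card_2_iff)
  have "le x x" "le y y" using po xy(1) unfolding poset_on_def by blast+
  moreover have "\<not> le x y" "\<not> le y x" using anti xy unfolding is_antichain_def by blast+
  moreover have "Q = {(if b then x else y) |(i::nat) b. i \<le> 0}"
    unfolding xy(1) by (auto intro: exI[of _ True] exI[of _ False])
  ultimately have "stack_rep le Q 0 (\<lambda>i b. if b then x else y)"
    unfolding stack_rep_def by (simp add: all_bool_eq)
  then show ?thesis using that by blast
qed

section \<open>Truncations, ordinal sums and duals of stacks\<close>

lemma poset_on_subset: "poset_on A le \<Longrightarrow> B \<subseteq> A \<Longrightarrow> poset_on B le"
  unfolding poset_on_def by (meson finite_subset subsetD)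

lemma stack_rep_lower:
  assumes "stack_rep le Q m a" "k \<le> m"
  shows "stack_rep le {a i b |i b. i \<le> k} k a"
  unfolding stack_rep_def using stack_rep_le[OF assms(1)] assms(2) by auto

lemma stack_rep_top:
  assumes "stack_rep le Q m a"
  shows "stack_rep le {a m True, a m False} 0 (\<lambda>i. a m)"
proof -
  have "{a m b |i b. i \<le> (0::nat)} = range (a m)" by auto
  also have "\<dots> = {a m True, a m False}" by (simp add: UNIV_bool insert_commute)
  finally show ?thesis unfolding stack_rep_def using stack_rep_le[OF assms] by simp
qed

text \<open>Comparing the top antichain of \<open>S\<close> with the bottom antichain of
  \<open>T\<close> suffices, because every point of \<open>S\<close> is at most some top point and
  every point of \<open>T\<close> is at least some bottom point. The antichain \<open>j\<close> of
  \<open>T\<close> receives the index \<open>Suc (m + j)\<close>.\<close>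

lemma stack_rep_append:
  assumes S: "stack_rep le S m a" and T: "stack_rep le T l b"
    and po: "poset_on (S \<union> T) le" and below: "set_lt le {a m True, a m False} {b 0 True, b 0 False}"
  shows "stack_rep le (S \<union> T) (Suc (m + l)) (\<lambda>i. if i \<le> m then a i else b (i - Suc m))"
    (is "stack_rep _ _ _ ?d")
    and "set_lt le S T"
proof -
  have mid: "lt le (a m c) (b 0 d)" for c d
    using below unfolding set_lt_def by (cases c; cases d) auto
  have lt: "lt le (a i c) (b j d)" if "i \<le> m" "j \<le> l" for i j c d
  proof -
    have "le (a i c) (a m c)" "le (b 0 d) (b j d)"
      using stack_rep_le[OF S] stack_rep_le[OF T] that by auto
    moreover have "a i c \<in> S \<union> T" "a m c \<in> S \<union> T" "b 0 d \<in> S \<union> T" "b j d \<in> S \<union> T"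
      using stack_rep_mem[OF S] stack_rep_mem[OF T] that by auto
    ultimately show ?thesis using mid[of c d] po unfolding lt_def poset_on_def by metis
  qed
  then show "set_lt le S T"
    unfolding set_lt_def using stack_rep_cases[OF S] stack_rep_cases[OF T] by metis
  have nle: "\<not> le (b j d) (a i c)" if "i \<le> m" "j \<le> l" for i j c d
    using lt[OF that] stack_rep_mem[OF S that(1)] stack_rep_mem[OF T that(2)] po
    unfolding lt_def poset_on_def by blast
  have Q: "S \<union> T = {?d i c |i c. i \<le> Suc (m + l)}"
  proof (intro set_eqI iffI)
    fix x assume "x \<in> S \<union> T"
    then show "x \<in> {?d i c |i c. i \<le> Suc (m + l)}"
    proof
      assume "x \<in> S"
      then obtain i c where "i \<le> m" "x = a i c" using stack_rep_cases[OF S] by blast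
      then show ?thesis by (intro CollectI exI[of _ i] exI[of _ c]) auto
    next
      assume "x \<in> T"
      then obtain i c where "i \<le> l" "x = b i c" using stack_rep_cases[OF T] by blast
      then show ?thesis by (intro CollectI exI[of _ "Suc (m + i)"] exI[of _ c]) auto
    qed
  qed (use stack_rep_mem[OF S] stack_rep_mem[OF T] in auto)
  have iff: "le (?d i c) (?d j e) \<longleftrightarrow> i < j \<or> i = j \<and> c = e"
    if "i \<le> Suc (m + l)" "j \<le> Suc (m + l)" for i j c e
  proof (cases "i \<le> m"; cases "j \<le> m")
    assume "i \<le> m" "j \<le> m"
    then show ?thesis using stack_rep_le[OF S] by simp
  next
    assume "i \<le> m" "\<not> j \<le> m"
    then show ?thesis using lt[of i "j - Suc m" c e] that unfolding lt_def by simp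
  next
    assume "\<not> i \<le> m" "j \<le> m"
    then show ?thesis using nle[of j "i - Suc m" c e] that by simp
  next
    assume "\<not> i \<le> m" "\<not> j \<le> m"
    then show ?thesis using stack_rep_le[OF T, of "i - Suc m" "j - Suc m" c e] that by auto
  qed
  show "stack_rep le (S \<union> T) (Suc (m + l)) ?d"
    unfolding stack_rep_def by (intro conjI allI impI Q iff)
qed

lemma stack_rep_converse:
  assumes "stack_rep le Q m a"
  shows "stack_rep (\<lambda>x y. le y x) Q m (\<lambda>i. a (m - i))"
proof -
  have "Q = {a (m - i) b |i b. i \<le> m}"
    using assms unfolding stack_rep_def by (auto, metis diff_diff_cancel diff_le_self)
  then show ?thesis unfolding stack_rep_def using stack_rep_le[OF assms] by fastforce
qed

lemma has_crown_stack_retractI: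
  assumes "retraction_on A le r" "stack_rep le (r ` A) m a" "m \<ge> 1"
  shows "has_crown_stack_retract A le"
  using assms stack_rep_crown4_stack unfolding has_crown_stack_retract_def by blast

lemma poset_on_converse: "poset_on A le \<Longrightarrow> poset_on A (\<lambda>x y. le y x)"
  unfolding poset_on_def by blast

text \<open>Levels are counted from the minimal points, so the self-duality of
  \<open>crown4_stack\<close> is not visible in its definition; in coordinates it is a reversal of
  the index.\<close>

lemma has_crown_stack_retract_converse:
  assumes "poset_on A le" "has_crown_stack_retract A le"
  shows "has_crown_stack_retract A (\<lambda>x y. le y x)"
proof -
  obtain r where r: "retraction_on A le r" "crown4_stack (r ` A) le"
    using assms(2) unfolding has_crown_stack_retract_def by blast
  have "r ` A \<subseteq> A" using r(1) unfolding retraction_on_def by blast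
  then have "poset_on (r ` A) le" by (rule poset_on_subset[OF assms(1)])
  then obtain m a where "m \<ge> 1" "stack_rep le (r ` A) m a" using crown4_stack_rep r(2) by blast
  moreover have "retraction_on A (\<lambda>x y. le y x) r" using r(1) unfolding retraction_on_def by blast
  ultimately show ?thesis by (blast intro: has_crown_stack_retractI[OF _ stack_rep_converse])
qed

section \<open>Gluing retractions\<close>

text \<open>Points of \<open>U\<close> are maximal in \<open>X\<close>, so the only proper relations
  starting in \<open>U\<close> lead into \<open>Y\<close>. Hence the image of such a point only has
  to be compatible with \<open>t\<close>, and the last hypothesis provides a choice in the bottom
  antichain of the upper stack for which it is.\<close>

lemma up_glue:
  assumes po: "poset_on (X \<union> Y) le" and disj: "X \<inter> Y = {}" and UX: "U \<subseteq> X"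
    and s: "retraction_on (X - U) le s" and t: "retraction_on Y le t"
    and S: "stack_rep le (s ` (X - U)) m a" and T: "stack_rep le (t ` Y) l b"
    and below: "set_lt le {a m True, a m False} {b 0 True, b 0 False}"
    and up: "\<And>x y. x \<in> X \<Longrightarrow> y \<in> Y \<Longrightarrow> \<not> le y x"
    and Umax: "\<And>u x. u \<in> U \<Longrightarrow> x \<in> X \<Longrightarrow> \<not> lt le u x"
    and U: "\<And>u. u \<in> U \<Longrightarrow> \<exists>v\<in>{b 0 True, b 0 False}. \<forall>p\<in>{p\<in>Y. t p = v}. \<not> lt le u p"
  shows "has_crown_stack_retract (X \<union> Y) le"
proof -
  \<comment> \<open>The flag is chosen so that \<open>b 0 (c u)\<close> becomes the image of
    \<open>u\<close> and the other point, \<open>b 0 (\<not> c u)\<close>, is the \<open>v\<close>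
    whose fibre contains nothing above \<open>u\<close>.\<close>
  have "\<exists>c. \<forall>p\<in>Y. t p = b 0 (\<not> c) \<longrightarrow> \<not> lt le u p" if u: "u \<in> U" for u
  proof -
    obtain v where v: "v \<in> {b 0 True, b 0 False}" "\<forall>p\<in>{p\<in>Y. t p = v}. \<not> lt le u p"
      using U[OF u] by blast
    show ?thesis
      using v by (cases "v = b 0 True") (auto intro: exI[of _ False] exI[of _ True])
  qed
  then obtain c where c: "\<And>u p. u \<in> U \<Longrightarrow> p \<in> Y \<Longrightarrow> t p = b 0 (\<not> c u) \<Longrightarrow> \<not> lt le u p" by metis
  define r where "r x = (if x \<in> Y then t x else if x \<in> U then b 0 (c x) else s x)" for x
  have sX: "s ` (X - U) \<subseteq> X - U" and tY: "t ` Y \<subseteq> Y"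
    using s t unfolding retraction_on_def by auto
  have "s ` (X - U) \<union> t ` Y \<subseteq> X \<union> Y" using sX tY by blast
  then have poST: "poset_on (s ` (X - U) \<union> t ` Y) le" by (rule poset_on_subset[OF po])
  have bY: "b 0 d \<in> t ` Y" for d using stack_rep_mem[OF T] by blast
  have tid: "t x = x" if "x \<in> t ` Y" for x using that t unfolding retraction_on_def by auto
  have rY: "r x = t x" if "x \<in> Y" for x using that unfolding r_def by simp
  have rU: "r x = b 0 (c x)" if "x \<in> U" for x using that disj UX unfolding r_def by auto
  have rS: "r x = s x" if "x \<in> X - U" for x using that disj unfolding r_def by auto
  have ST: "lt le (s x) y" if "x \<in> X - U" "y \<in> t ` Y" for x y
    using stack_rep_append(2)[OF S T poST below] that unfolding set_lt_def by blast
  have idem: "r (r x) = r x" if "x \<in> X \<union> Y" for x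
  proof (cases "x \<in> X - U")
    case True
    then have "s x \<in> X - U" "s (s x) = s x" using s unfolding retraction_on_def by auto
    then show ?thesis using rS True by simp
  next
    case False
    then have "r x \<in> t ` Y" using rU rY that bY by auto
    then show ?thesis using rY tid tY by (metis subsetD)
  qed
  have mono: "le (r x) (r y)" if xy: "x \<in> X \<union> Y" "y \<in> X \<union> Y" "le x y" for x y
  proof -
    consider "x \<in> X - U" "y \<in> X - U" | "x \<in> X - U" "y \<in> U \<union> Y" | "x \<in> U" "y \<in> X"
      | "x \<in> U" "y \<in> Y" | "x \<in> Y" "y \<in> X" | "x \<in> Y" "y \<in> Y"
      using xy UX by blast
    then show ?thesis
    proof cases
      case 1
      then show ?thesis using rS s xy unfolding retraction_on_def by auto
    next
      case 2
      then have "r y \<in> t ` Y" using rU rY bY by auto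
      then show ?thesis using ST[OF 2(1)] rS[OF 2(1)] unfolding lt_def by simp
    next
      case 3
      then have "x = y" using Umax xy unfolding lt_def by blast
      then show ?thesis using rU 3 stack_rep_le[OF T] by simp
    next
      case 4
      then have "lt le x y" using xy disj UX unfolding lt_def by auto
      then have ne: "t y \<noteq> b 0 (\<not> c x)" using c 4 by blast
      obtain j d where j: "j \<le> l" "t y = b j d" using stack_rep_cases[OF T] 4 by blast
      \<comment> \<open>As \<open>t y\<close> is not the avoided point, it is either the image of
        \<open>x\<close> itself or on a higher antichain, hence above that image in both
        cases.\<close>
      then have "0 < j \<or> c x = d" using ne by (cases "j = 0"; cases "d = c x") auto
      then show ?thesis using rU rY 4 j stack_rep_le[OF T] by auto
    next
      case 5
      then show ?thesis using up xy by blast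
    next
      case 6
      then show ?thesis using rY t xy unfolding retraction_on_def by auto
    qed
  qed
  have im: "r ` (X \<union> Y) = s ` (X - U) \<union> t ` Y"
  proof -
    have dec: "r ` (X \<union> Y) = r ` (X - U) \<union> r ` U \<union> r ` Y" using UX by blast
    have rXU: "r ` (X - U) = s ` (X - U)" by (rule image_cong[OF refl rS])
    have rY': "r ` Y = t ` Y" by (rule image_cong[OF refl rY])
    have rU': "r ` U \<subseteq> t ` Y" using rU bY by auto
    show ?thesis by (simp only: dec rXU rY' Un_assoc Un_absorb1[OF rU'])
  qed
  have "r x \<in> X \<union> Y" if "x \<in> X \<union> Y" for x
    using imageI[OF that, of r] sX tY unfolding im by blast
  then have "retraction_on (X \<union> Y) le r"
    unfolding retraction_on_def by (intro conjI ballI impI idem mono)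
  \<comment> \<open>The joined stack has top index \<open>Suc (m + l)\<close>, so it has height at
    least 1 even if both parts are just two-element antichains.\<close>
  then show ?thesis
    by (rule has_crown_stack_retractI) (simp_all only: im, rule stack_rep_append(1)[OF S T poST below], simp)
qed

text \<open>This is \<open>up_glue\<close> for the reversed order, with \<open>X\<close> and
  \<open>Y\<close> exchanged. Reversing the indices turns the top antichain of the lower stack into
  the bottom one that \<open>up_glue\<close> expects.\<close>

lemma down_glue:
  assumes po: "poset_on (X \<union> Y) le" and disj: "X \<inter> Y = {}" and DY: "D \<subseteq> Y"
    and s: "retraction_on (Y - D) le s" and t: "retraction_on X le t"
    and S: "stack_rep le (s ` (Y - D)) m a" and T: "stack_rep le (t ` X) l b"
    and below: "set_lt le {b l True, b l False} {a 0 True, a 0 False}"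
    and up: "\<And>x y. x \<in> X \<Longrightarrow> y \<in> Y \<Longrightarrow> \<not> le y x"
    and Dmin: "\<And>d y. d \<in> D \<Longrightarrow> y \<in> Y \<Longrightarrow> \<not> lt le y d"
    and D: "\<And>d. d \<in> D \<Longrightarrow> \<exists>v\<in>{b l True, b l False}. \<forall>p\<in>{p\<in>X. t p = v}. \<not> lt le p d"
  shows "has_crown_stack_retract (X \<union> Y) le"
proof -
  let ?ge = "\<lambda>x y. le y x"
  have lt: "lt ?ge x y \<longleftrightarrow> lt le y x" for x y unfolding lt_def by auto
  have "has_crown_stack_retract (Y \<union> X) ?ge"
  proof (rule up_glue[OF _ _ DY])
    show "poset_on (Y \<union> X) ?ge" using poset_on_converse[OF po] by (simp add: Un_commute)
    show "retraction_on (Y - D) ?ge s" "retraction_on X ?ge t"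
      using s t unfolding retraction_on_def by blast+
    show "stack_rep ?ge (s ` (Y - D)) m (\<lambda>i. a (m - i))" "stack_rep ?ge (t ` X) l (\<lambda>i. b (l - i))"
      using stack_rep_converse S T by blast+
    show "set_lt ?ge {a (m - m) True, a (m - m) False} {b (l - 0) True, b (l - 0) False}"
      using below unfolding set_lt_def lt by auto
  qed (use disj up Dmin D in \<open>auto simp: lt\<close>)
  then show ?thesis
    using has_crown_stack_retract_converse poset_on_converse[OF po] by (fastforce simp: Un_commute)
qed

section \<open>Posets of horizon two\<close>

lemma fixed_subset_image:
  assumes "\<And>x. x \<in> X \<Longrightarrow> r x = x" "X \<subseteq> B"
  shows "X \<subseteq> r ` B"
proof
  fix x assume "x \<in> X"
  then show "x \<in> r ` B" using assms by (intro image_eqI[of _ _ x]) auto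
qed

text \<open>The last but one condition is the trace of the 6-crowns: two upper covers \<open>u\<close>, \<open>v\<close> of \<open>p\<close> exclude type 3C.\<close>
definition horizon_two ::
    "'a set \<Rightarrow> ('a \<Rightarrow> 'a \<Rightarrow> bool) \<Rightarrow> ('a \<Rightarrow> nat) \<Rightarrow> bool" where
  "horizon_two A le lev \<longleftrightarrow> poset_on A le
    \<and> (\<forall>i j. levels A le i j = {x\<in>A. i \<le> lev x \<and> lev x \<le> j})
    \<and> (\<forall>x\<in>A. lev x \<le> height A le)
    \<and> (\<forall>x\<in>A. \<forall>y\<in>A. lt le x y \<longrightarrow> lev x < lev y)
    \<and> (\<forall>x\<in>A. \<forall>y\<in>A. lev x + 2 \<le> lev y \<longrightarrow> lt le x y)
    \<and> (\<forall>x\<in>A. lev x < height A le \<longrightarrow> (\<exists>y\<in>A. lt le x y \<and> lev y = Suc (lev x)))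
    \<and> (\<forall>p\<in>A. \<forall>y\<in>A. \<forall>u\<in>A. \<forall>v\<in>A. \<forall>x\<in>A. lev p = lev y \<longrightarrow> lev u = Suc (lev p) \<longrightarrow> lev v = lev u
        \<longrightarrow> lev x = lev u \<longrightarrow> u \<noteq> v \<longrightarrow> lt le p u \<longrightarrow> lt le p v \<longrightarrow> x \<noteq> u \<longrightarrow> x \<noteq> v
        \<longrightarrow> \<not> lt le y x \<longrightarrow> y = p)
    \<and> (\<forall>x\<in>A. \<forall>y\<in>A. lev x = lev y \<longrightarrow> lev x < height A le \<longrightarrow> (\<exists>w\<in>A. lt le x w \<and> lt le y w))"

lemma horizon_twoD:
  assumes "horizon_two A le lev"
  shows "poset_on A le"
    and "levels A le i j = {x\<in>A. i \<le> lev x \<and> lev x \<le> j}"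
    and "x \<in> A \<Longrightarrow> lev x \<le> height A le"
    and "x \<in> A \<Longrightarrow> y \<in> A \<Longrightarrow> lt le x y \<Longrightarrow> lev x < lev y"
    and "x \<in> A \<Longrightarrow> y \<in> A \<Longrightarrow> lev x + 2 \<le> lev y \<Longrightarrow> lt le x y"
    and "x \<in> A \<Longrightarrow> lev x < height A le \<Longrightarrow> \<exists>y\<in>A. lt le x y \<and> lev y = Suc (lev x)"
    and "x \<in> A \<Longrightarrow> y \<in> A \<Longrightarrow> lev x = lev y \<Longrightarrow> lev x < height A le
      \<Longrightarrow> \<exists>w\<in>A. lt le x w \<and> lt le y w"
  using assms unfolding horizon_two_def by simp_all

lemma horizon_two_crown:
  assumes "horizon_two A le lev" "p \<in> A" "y \<in> A" "u \<in> A" "v \<in> A" "x \<in> A"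
    and "lev p = lev y" "lev u = Suc (lev p)" "lev v = lev u" "lev x = lev u"
    and "u \<noteq> v" "lt le p u" "lt le p v" "x \<noteq> u" "x \<noteq> v" "\<not> lt le y x"
  shows "y = p"
  using assms unfolding horizon_two_def by meson

text \<open>Beyond translating levels into coordinates, the point to check for
  \<open>up_glue\<close> is that \<open>U\<close> is maximal in the lower part; this is where
  horizon two enters.\<close>

lemma up_split_imp:
  assumes hz: "horizon_two A le lev"
    and split: "retractive_up_split A le k U s t"
    and S: "S = s ` (levels A le 0 k - U)" and B: "B = levels A le (Suc k) (height A le)"
    and T: "T = t ` B"
    and below: "set_lt le (level S le (height S le)) (level T le 0)"
    and U: "\<forall>u\<in>U. \<exists>v\<in>level T le 0. \<forall>p\<in>{p\<in>B. t p = v}. \<not> lt le u p"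
  shows "has_crown_stack_retract A le"
proof -
  note po = horizon_twoD(1)[OF hz] and levels_eq = horizon_twoD(2)[OF hz]
    and lev_le = horizon_twoD(3)[OF hz] and lev_mono = horizon_twoD(4)[OF hz]
    and far = horizon_twoD(5)[OF hz]
  define X where "X = levels A le 0 k"
  have sp: "k < height A le" "U \<subset> X" "retraction_on (X - U) le s" "good_target S le"
    "retraction_on B le t" "good_target T le"
    using split unfolding retractive_up_split_def S T B X_def by auto
  have Xe: "X = {x\<in>A. lev x \<le> k}" and Be: "B = {x\<in>A. Suc k \<le> lev x}"
    using sp(1) lev_le unfolding X_def B by (auto simp: levels_eq)
  have XB: "X \<union> B = A" "X \<inter> B = {}" unfolding Xe Be by auto
  have sub: "S \<subseteq> A" "T \<subseteq> B" using sp(3,5) XB unfolding S T retraction_on_def X_def[symmetric] by auto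
  have "T \<subseteq> A" using sub(2) XB by blast
  then have poST: "poset_on S le" "poset_on T le"
    using sub(1) by (simp_all add: poset_on_subset[OF po])
  obtain m a where a: "stack_rep le S m a" using good_target_rep[OF poST(1) sp(4)] .
  obtain l b where b: "stack_rep le T l b" using good_target_rep[OF poST(2) sp(6)] .
  have lS: "level S le (height S le) = {a m True, a m False}" "level T le 0 = {b 0 True, b 0 False}"
    using stack_rep_rest(2)[OF a, of m] stack_rep_rest(2)[OF b, of 0] stack_rep_height[OF a] by auto
  \<comment> \<open>A point \<open>v\<close> of the bottom antichain of \<open>T\<close> is fixed by
    \<open>t\<close>, so it belongs to its own fibre and is not above \<open>u\<close>. Since
    \<open>v\<close> lies above level \<open>k\<close> and a gap of two levels forces comparability,
    \<open>u\<close> must be on level \<open>k\<close>.\<close>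
  have Uk: "lev u = k" if u: "u \<in> U" for u
  proof -
    obtain v where v: "v \<in> level T le 0" "\<forall>p\<in>{p\<in>B. t p = v}. \<not> lt le u p" using U u by blast
    have "v \<in> T" using v(1) lS(2) stack_rep_mem[OF b] by auto
    then have "v \<in> B" "t v = v" using sub sp(5) unfolding T retraction_on_def by auto
    then have "\<not> lt le u v" using v by blast
    then have "\<not> lev u + 2 \<le> lev v" using far[of u v] u \<open>v \<in> B\<close> sp(2) XB by blast
    then show ?thesis using \<open>v \<in> B\<close> u sp(2) unfolding Xe Be by auto
  qed
  have "has_crown_stack_retract (X \<union> B) le"
  proof (rule up_glue[of X B le U s t m a l b])
    show "\<not> le y x" if "x \<in> X" "y \<in> B" for x y
      using lev_mono[of y x] that unfolding Xe Be lt_def by (cases "y = x") auto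
    show "\<not> lt le u x" if "u \<in> U" "x \<in> X" for u x
      using lev_mono[of u x] Uk[OF that(1)] that sp(2) unfolding Xe by auto
  qed (use po XB sp a b below lS U in \<open>auto simp: S T X_def\<close>)
  then show ?thesis using XB by simp
qed

text \<open>Mirror image of \<open>up_split_imp\<close>: the points of \<open>D\<close> end up on
  level \<open>k\<close>, the lowest of the upper part, and are therefore minimal there.\<close>

lemma down_split_imp:
  assumes hz: "horizon_two A le lev"
    and split: "retractive_down_split A le k D s t"
    and S: "S = s ` (levels A le k (height A le) - D)" and B: "B = levels A le 0 (k - 1)"
    and T: "T = t ` B"
    and below: "set_lt le (level T le (height T le)) (level S le 0)"
    and D: "\<forall>d\<in>D. \<exists>v\<in>level T le (height T le). \<forall>p\<in>{p\<in>B. t p = v}. \<not> lt le p d"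
  shows "has_crown_stack_retract A le"
proof -
  note po = horizon_twoD(1)[OF hz] and levels_eq = horizon_twoD(2)[OF hz]
    and lev_le = horizon_twoD(3)[OF hz] and lev_mono = horizon_twoD(4)[OF hz]
    and far = horizon_twoD(5)[OF hz]
  define Y where "Y = levels A le k (height A le)"
  have sp: "1 \<le> k" "k \<le> height A le" "D \<subset> Y" "retraction_on (Y - D) le s" "good_target S le"
    "retraction_on B le t" "good_target T le"
    using split unfolding retractive_down_split_def S T B Y_def by auto
  have Be: "B = {x\<in>A. lev x < k}" and Ye: "Y = {x\<in>A. k \<le> lev x}"
    using sp(1,2) lev_le unfolding Y_def B by (auto simp: levels_eq)
  have BY: "B \<union> Y = A" "B \<inter> Y = {}" unfolding Ye Be by auto
  have sub: "S \<subseteq> A" "T \<subseteq> B" using sp(4,6) BY unfolding S T retraction_on_def Y_def[symmetric] by auto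
  have "T \<subseteq> A" using sub(2) BY by blast
  then have poST: "poset_on S le" "poset_on T le"
    using sub(1) by (simp_all add: poset_on_subset[OF po])
  obtain m a where a: "stack_rep le S m a" using good_target_rep[OF poST(1) sp(5)] .
  obtain l b where b: "stack_rep le T l b" using good_target_rep[OF poST(2) sp(7)] .
  have lS: "level T le (height T le) = {b l True, b l False}" "level S le 0 = {a 0 True, a 0 False}"
    using stack_rep_rest(2)[OF a, of 0] stack_rep_rest(2)[OF b, of l] stack_rep_height[OF b] by auto
  have Dk: "lev d = k" if d: "d \<in> D" for d
  proof -
    obtain v where v: "v \<in> level T le (height T le)" "\<forall>p\<in>{p\<in>B. t p = v}. \<not> lt le p d"
      using D d by blast
    have "v \<in> T" using v(1) lS(1) stack_rep_mem[OF b] by auto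
    then have "v \<in> B" "t v = v" using sub sp(6) unfolding T retraction_on_def by auto
    then have "\<not> lt le v d" using v by blast
    then have "\<not> lev v + 2 \<le> lev d" using far[of v d] d \<open>v \<in> B\<close> sp(3) BY by blast
    then show ?thesis using \<open>v \<in> B\<close> d sp(3) unfolding Ye Be by auto
  qed
  have "has_crown_stack_retract (B \<union> Y) le"
  proof (rule down_glue[of B Y le D s t m a l b])
    show "\<not> le y x" if "x \<in> B" "y \<in> Y" for x y
      using lev_mono[of y x] that unfolding Ye Be lt_def by (cases "y = x") auto
    show "\<not> lt le y d" if "d \<in> D" "y \<in> Y" for d y
      using lev_mono[of y d] Dk[OF that(1)] that sp(3) unfolding Ye by auto
  qed (use po BY sp a b below lS D in \<open>auto simp: S T Y_def\<close>)
  then show ?thesis using BY by simp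
qed

text \<open>The single map \<open>r\<close> serves as both \<open>s\<close> and \<open>t\<close>.
  The set \<open>U\<close> collects the points up to level \<open>k\<close> that \<open>r\<close>
  carries across the cut into the top antichain; once they are removed, \<open>r\<close> preserves
  both parts.\<close>

lemma up_split_exists:
  assumes hz: "horizon_two A le lev"
    and r: "retraction_on A le r" and a: "stack_rep le (r ` A) (Suc n) a"
    and k: "k < height A le"
    and low: "\<And>i b. i \<le> n \<Longrightarrow> lev (a i b) \<le> k" and top: "\<And>b. k < lev (a (Suc n) b)"
    and up: "\<And>x. x \<in> A \<Longrightarrow> k < lev x \<Longrightarrow> r x \<in> {a (Suc n) True, a (Suc n) False}"
  shows "\<exists>k U s t. retractive_up_split A le k U s t \<and>
        (let S = s ` (levels A le 0 k - U);
             B = levels A le (Suc k) (height A le);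
             T = t ` B
         in set_lt le (level S le (height S le)) (level T le 0)
            \<and> (\<forall>u\<in>U. \<exists>v\<in>level T le 0. \<forall>p\<in>{p\<in>B. t p = v}. \<not> lt le u p))"
proof -
  note levels_eq = horizon_twoD(2)[OF hz] and lev_le = horizon_twoD(3)[OF hz]
  define Lo where "Lo = {a i b |i b. i \<le> n}"
  define Top where "Top = {a (Suc n) True, a (Suc n) False}"
  define B where "B = levels A le (Suc k) (height A le)"
  define U where "U = {x\<in>A. lev x \<le> k \<and> r x \<in> Top}"
  have Be: "B = {x\<in>A. k < lev x}" using lev_le unfolding B_def by (auto simp: levels_eq)
  have Xe: "levels A le 0 k = {x\<in>A. lev x \<le> k}" using k by (auto simp: levels_eq)
  have rA: "r ` A \<subseteq> A" and rid: "\<And>x. x \<in> r ` A \<Longrightarrow> r x = x"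
    and rmono: "\<And>x y. x \<in> A \<Longrightarrow> y \<in> A \<Longrightarrow> le x y \<Longrightarrow> le (r x) (r y)"
    using r unfolding retraction_on_def by auto
  have aR: "a i b \<in> r ` A" if "i \<le> Suc n" for i b using stack_rep_mem[OF a that] .
  have split: "r x \<in> Lo \<or> r x \<in> Top" if x: "x \<in> A" for x
  proof -
    obtain i b where "i \<le> Suc n" "r x = a i b" using stack_rep_cases[OF a] x by blast
    then show ?thesis unfolding Lo_def Top_def by (cases "i \<le> n"; cases b) (auto simp: le_Suc_eq)
  qed
  have disj: "Lo \<inter> Top = {}"
    using stack_rep_eq_iff[OF a] unfolding Lo_def Top_def by auto
  have XU: "levels A le 0 k - U = {x\<in>A. lev x \<le> k \<and> r x \<in> Lo}"
    using split disj unfolding Xe U_def by auto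
  have LoR: "Lo \<subseteq> r ` A" and TopR: "Top \<subseteq> r ` A" using aR unfolding Lo_def Top_def by auto
  have LoX: "Lo \<subseteq> levels A le 0 k - U"
  proof
    fix p assume p: "p \<in> Lo"
    then have "p \<in> A" "r p = p" using LoR rA rid by blast+
    moreover have "lev p \<le> k" using p low unfolding Lo_def by blast
    ultimately show "p \<in> levels A le 0 k - U" using p unfolding XU by simp
  qed
  have TopB: "Top \<subseteq> B"
  proof
    fix p assume p: "p \<in> Top"
    then have "p \<in> A" using TopR rA by blast
    moreover have "k < lev p" using p top unfolding Top_def by blast
    ultimately show "p \<in> B" unfolding Be by simp
  qed
  have S: "r ` (levels A le 0 k - U) = Lo"
  proof
    show "Lo \<subseteq> r ` (levels A le 0 k - U)" by (rule fixed_subset_image[OF _ LoX]) (use LoR rid in blast)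
  qed (use XU in auto)
  have T: "r ` B = Top"
  proof
    show "Top \<subseteq> r ` B" by (rule fixed_subset_image[OF _ TopB]) (use TopR rid in blast)
  qed (use up in \<open>auto simp: Be Top_def\<close>)
  have LoS: "stack_rep le Lo n a" using stack_rep_lower[OF a] unfolding Lo_def by simp
  have TopS: "stack_rep le Top 0 (\<lambda>i. a (Suc n))" using stack_rep_top[OF a] unfolding Top_def .
  have lvl: "level Lo le (height Lo le) = {a n True, a n False}" "level Top le 0 = Top"
    using stack_rep_rest(2)[OF LoS] stack_rep_rest(2)[OF TopS] stack_rep_height[OF LoS]
    unfolding Top_def by auto
  have "U \<subset> levels A le 0 k"
    using LoX unfolding U_def Xe Lo_def by blast
  moreover have "retraction_on (levels A le 0 k - U) le r"
    using S LoX LoR rid rmono unfolding retraction_on_def XU by blast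
  moreover have "retraction_on B le r"
    using T TopB TopR rid rmono unfolding retraction_on_def Be by blast
  ultimately have split: "retractive_up_split A le k U r r"
    using k S T stack_rep_good_target[OF LoS] stack_rep_good_target[OF TopS]
    unfolding retractive_up_split_def B_def by simp
  have below: "set_lt le {a n True, a n False} Top"
    unfolding set_lt_def Top_def using stack_rep_lt[OF a] by auto
  \<comment> \<open>The required \<open>v\<close> is the top point different from
    \<open>r u\<close>: anything above \<open>u\<close> has its image above \<open>r u\<close>, and
    the two top points are incomparable.\<close>
  have "\<exists>v\<in>Top. \<forall>p\<in>{p\<in>B. r p = v}. \<not> lt le u p" if u: "u \<in> U" for u
  proof -
    obtain b where b: "r u = a (Suc n) b" using u unfolding U_def Top_def by blast
    have "\<not> lt le u p" if "p \<in> B" "r p = a (Suc n) (\<not> b)" for p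
    proof
      assume "lt le u p"
      then have "le (r u) (r p)" using rmono[of u p] u that(1) unfolding U_def Be lt_def by simp
      then show False using b that stack_rep_le[OF a] by simp
    qed
    moreover have "a (Suc n) (\<not> b) \<in> Top" unfolding Top_def by (cases b) auto
    ultimately show ?thesis by blast
  qed
  then show ?thesis
    using split below unfolding Let_def
    by (intro exI[of _ k] exI[of _ U] exI[of _ r]) (simp add: B_def[symmetric] S T lvl)
qed

text \<open>Again \<open>r\<close> serves as both maps, and \<open>D\<close> collects the points
  above level \<open>k\<close> that \<open>r\<close> carries down across the cut. The split index is
  \<open>Suc k\<close>, so that the lower part, ending at index minus one, ends at level
  \<open>k\<close>.\<close>

lemma down_split_exists:
  assumes hz: "horizon_two A le lev"
    and r: "retraction_on A le r" and a: "stack_rep le (r ` A) (Suc n) a"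
    and k: "k < height A le"
    and low: "\<And>i b. i \<le> n \<Longrightarrow> lev (a i b) \<le> k" and top: "\<And>b. k < lev (a (Suc n) b)"
    and down: "\<And>x. x \<in> A \<Longrightarrow> lev x \<le> k \<Longrightarrow> r x \<notin> {a (Suc n) True, a (Suc n) False}"
  shows "\<exists>k D s t. retractive_down_split A le k D s t \<and>
        (let S = s ` (levels A le k (height A le) - D);
             B = levels A le 0 (k - 1);
             T = t ` B
         in set_lt le (level T le (height T le)) (level S le 0)
            \<and> (\<forall>d\<in>D. \<exists>v\<in>level T le (height T le). \<forall>p\<in>{p\<in>B. t p = v}. \<not> lt le p d))"
proof -
  note levels_eq = horizon_twoD(2)[OF hz] and lev_le = horizon_twoD(3)[OF hz]
  define Lo where "Lo = {a i b |i b. i \<le> n}"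
  define Top where "Top = {a (Suc n) True, a (Suc n) False}"
  define B where "B = levels A le 0 k"
  define D where "D = {x\<in>A. k < lev x \<and> r x \<in> Lo}"
  have Be: "B = {x\<in>A. lev x \<le> k}" using k unfolding B_def by (auto simp: levels_eq)
  have Ye: "levels A le (Suc k) (height A le) = {x\<in>A. k < lev x}"
    using lev_le by (auto simp: levels_eq)
  have rA: "r ` A \<subseteq> A" and rid: "\<And>x. x \<in> r ` A \<Longrightarrow> r x = x"
    and rmono: "\<And>x y. x \<in> A \<Longrightarrow> y \<in> A \<Longrightarrow> le x y \<Longrightarrow> le (r x) (r y)"
    using r unfolding retraction_on_def by auto
  have aR: "a i b \<in> r ` A" if "i \<le> Suc n" for i b using stack_rep_mem[OF a that] .
  have split: "r x \<in> Lo \<or> r x \<in> Top" if x: "x \<in> A" for x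
  proof -
    obtain i b where "i \<le> Suc n" "r x = a i b" using stack_rep_cases[OF a] x by blast
    then show ?thesis unfolding Lo_def Top_def by (cases "i \<le> n"; cases b) (auto simp: le_Suc_eq)
  qed
  have disj: "Lo \<inter> Top = {}"
    using stack_rep_eq_iff[OF a] unfolding Lo_def Top_def by auto
  have YD: "levels A le (Suc k) (height A le) - D = {x\<in>A. k < lev x \<and> r x \<in> Top}"
    using split disj unfolding Ye D_def by auto
  have LoR: "Lo \<subseteq> r ` A" and TopR: "Top \<subseteq> r ` A" using aR unfolding Lo_def Top_def by auto
  have TopY: "Top \<subseteq> levels A le (Suc k) (height A le) - D"
  proof
    fix p assume p: "p \<in> Top"
    then have "p \<in> A" "r p = p" using TopR rA rid by blast+
    moreover have "k < lev p" using p top unfolding Top_def by blast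
    ultimately show "p \<in> levels A le (Suc k) (height A le) - D" using p unfolding YD by simp
  qed
  have LoB: "Lo \<subseteq> B"
  proof
    fix p assume p: "p \<in> Lo"
    then have "p \<in> A" using LoR rA by blast
    moreover have "lev p \<le> k" using p low unfolding Lo_def by blast
    ultimately show "p \<in> B" unfolding Be by simp
  qed
  have S: "r ` (levels A le (Suc k) (height A le) - D) = Top"
  proof
    show "Top \<subseteq> r ` (levels A le (Suc k) (height A le) - D)"
      by (rule fixed_subset_image[OF _ TopY]) (use TopR rid in blast)
  qed (use YD in auto)
  have T: "r ` B = Lo"
  proof
    show "Lo \<subseteq> r ` B" by (rule fixed_subset_image[OF _ LoB]) (use LoR rid in blast)
    show "r ` B \<subseteq> Lo" using split down unfolding Be Top_def by blast
  qed
  have LoS: "stack_rep le Lo n a" using stack_rep_lower[OF a] unfolding Lo_def by simp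
  have TopS: "stack_rep le Top 0 (\<lambda>i. a (Suc n))" using stack_rep_top[OF a] unfolding Top_def .
  have lvl: "level Lo le (height Lo le) = {a n True, a n False}" "level Top le 0 = Top"
    using stack_rep_rest(2)[OF LoS] stack_rep_rest(2)[OF TopS] stack_rep_height[OF LoS]
    unfolding Top_def by auto
  have "D \<subset> levels A le (Suc k) (height A le)"
    using TopY unfolding D_def Ye Top_def by blast
  moreover have "retraction_on (levels A le (Suc k) (height A le) - D) le r"
    using S TopY TopR rid rmono unfolding retraction_on_def YD by blast
  moreover have "retraction_on B le r"
    using T LoB LoR rid rmono unfolding retraction_on_def Be by blast
  ultimately have split: "retractive_down_split A le (Suc k) D r r"
    using k S T stack_rep_good_target[OF LoS] stack_rep_good_target[OF TopS]
    unfolding retractive_down_split_def B_def by simp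
  have below: "set_lt le {a n True, a n False} Top"
    unfolding set_lt_def Top_def using stack_rep_lt[OF a] by auto
  have "\<exists>v\<in>{a n True, a n False}. \<forall>p\<in>{p\<in>B. r p = v}. \<not> lt le p d" if d: "d \<in> D" for d
  proof -
    \<comment> \<open>Here \<open>r d\<close> may lie on any antichain \<open>i\<close> up to
      \<open>n\<close>. The point of antichain \<open>n\<close> with the opposite flag is never
      below it: it is incomparable if \<open>i = n\<close> and strictly above if
      \<open>i < n\<close>.\<close>
    obtain i b where b: "r d = a i b" "i \<le> n" using d unfolding D_def Lo_def by blast
    have "\<not> lt le p d" if "p \<in> B" "r p = a n (\<not> b)" for p
    proof
      assume "lt le p d"
      then have "le (r p) (r d)" using rmono[of p d] d that(1) unfolding D_def Be lt_def by simp
      then show False using b that stack_rep_le[OF a, of n i] by simp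
    qed
    moreover have "a n (\<not> b) \<in> {a n True, a n False}" by (cases b) auto
    ultimately show ?thesis by blast
  qed
  then show ?thesis
    using split below unfolding Let_def
    by (intro exI[of _ "Suc k"] exI[of _ D] exI[of _ r]) (simp add: B_def[symmetric] S T lvl)
qed

lemma crown_stack_retract_splits:
  assumes hz: "horizon_two A le lev"
    and stack: "has_crown_stack_retract A le"
  shows "(\<exists>k U s t. retractive_up_split A le k U s t \<and>
        (let S = s ` (levels A le 0 k - U);
             B = levels A le (Suc k) (height A le);
             T = t ` B
         in set_lt le (level S le (height S le)) (level T le 0)
            \<and> (\<forall>u\<in>U. \<exists>v\<in>level T le 0. \<forall>p\<in>{p\<in>B. t p = v}. \<not> lt le u p)))
     \<or> (\<exists>k D s t. retractive_down_split A le k D s t \<and>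
        (let S = s ` (levels A le k (height A le) - D);
             B = levels A le 0 (k - 1);
             T = t ` B
         in set_lt le (level T le (height T le)) (level S le 0)
            \<and> (\<forall>d\<in>D. \<exists>v\<in>level T le (height T le). \<forall>p\<in>{p\<in>B. t p = v}. \<not> lt le p d)))"
    (is "?up \<or> ?down")
proof -
  note po = horizon_twoD(1)[OF hz] and levels_eq = horizon_twoD(2)[OF hz]
    and lev_le = horizon_twoD(3)[OF hz] and lev_mono = horizon_twoD(4)[OF hz]
    and far = horizon_twoD(5)[OF hz] and upper_cover = horizon_twoD(6)[OF hz]
    and common_upper = horizon_twoD(7)[OF hz]
  obtain r where r: "retraction_on A le r" "crown4_stack (r ` A) le"
    using stack unfolding has_crown_stack_retract_def by blast
  have rA: "r ` A \<subseteq> A" and rid: "\<And>x. x \<in> r ` A \<Longrightarrow> r x = x"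
    and rmono: "\<And>x y. x \<in> A \<Longrightarrow> y \<in> A \<Longrightarrow> lt le x y \<Longrightarrow> le (r x) (r y)"
    using r(1) unfolding retraction_on_def lt_def by auto
  obtain m a where "m \<ge> 1" "stack_rep le (r ` A) m a"
    using crown4_stack_rep[OF poset_on_subset[OF po rA] r(2)] .
  then obtain n where a: "stack_rep le (r ` A) (Suc n) a" by (cases m) auto
  have aR: "a i b \<in> r ` A" if "i \<le> Suc n" for i b using stack_rep_mem[OF a that] .
  have aA: "a i b \<in> A" if "i \<le> Suc n" for i b using aR[OF that] rA by blast
  \<comment> \<open>The flag \<open>c\<close> selects the top point of smaller level, so that
    \<open>u\<close> is never on a higher level than \<open>v\<close>.\<close>
  define c where "c \<longleftrightarrow> lev (a (Suc n) True) \<le> lev (a (Suc n) False)"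
  define u where "u = a (Suc n) c"
  define v where "v = a (Suc n) (\<not> c)"
  have uv: "{a (Suc n) True, a (Suc n) False} = {u, v}"
    unfolding u_def v_def by (cases c) auto
  have lev_uv: "lev u \<le> lev v" using c_def unfolding u_def v_def by (cases c) simp_all
  have uvA: "u \<in> A" "v \<in> A" using aA unfolding u_def v_def by auto
  have fix_uv: "r u = u" "r v = v" unfolding u_def v_def by (rule rid[OF aR], simp)+
  have inc: "u \<noteq> v" "\<not> le u v" "\<not> le v u"
    using stack_rep_le[OF a, of "Suc n" "Suc n"] stack_rep_eq_iff[OF a, of "Suc n" "Suc n"]
    unfolding u_def v_def by simp_all
  have above: "r x = w" if x: "x \<in> A" "w \<in> {u, v}" "le w (r x)" for x w
  proof -
    obtain i b where ib: "i \<le> Suc n" "r x = a i b" using stack_rep_cases[OF a] x(1) by blast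
    obtain d where w: "w = a (Suc n) d" using x(2) unfolding u_def v_def by blast
    have "i = Suc n \<and> b = d" using x(3) ib stack_rep_le[OF a, of "Suc n" i d b] unfolding w by auto
    then show ?thesis using ib w by simp
  qed
  \<comment> \<open>No stack point outside the top antichain dominates both points of antichain
    \<open>n\<close>; the one with the opposite flag is missed.\<close>
  have below: "\<not> (\<forall>b. le (a n b) (r x))" if x: "x \<in> A" "r x \<notin> {u, v}" for x
  proof -
    obtain i b where ib: "i \<le> Suc n" "r x = a i b" using stack_rep_cases[OF a] x(1) by blast
    have "a (Suc n) b \<in> {u, v}" unfolding u_def v_def by (cases b; cases c) simp_all
    then have "i \<le> n" using ib x(2) by (auto simp: le_Suc_eq)
    then have "\<not> le (a n (\<not> b)) (r x)" using ib stack_rep_le[OF a, of n i "\<not> b" b] by simp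
    then show ?thesis by blast
  qed
  have low_lt: "lt le (a i b) u" if "i \<le> n" for i b
    using stack_rep_lt[OF a, of i "Suc n"] that unfolding u_def by simp
  have low_lt': "lt le (a i b) v" if "i \<le> n" for i b
    using stack_rep_lt[OF a, of i "Suc n"] that unfolding v_def by simp
  have low_lev: "lev (a i b) < lev u" if "i \<le> n" for i b
    using lev_mono[OF _ uvA(1) low_lt[OF that]] aA that by simp
  then obtain k where k: "lev u = Suc k" by (metis less_nat_zero_code not0_implies_Suc order_refl)
  have kh: "k < height A le" using lev_le[OF uvA(1)] k by simp
  have low: "lev (a i b) \<le> k" if "i \<le> n" for i b using low_lev[OF that, of b] k by simp
  have top: "k < lev (a (Suc n) b)" for b using lev_uv k u_def v_def by (cases "b = c") auto
  have near: "\<not> lev u + 2 \<le> lev v" using far uvA inc(2) unfolding lt_def by blast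
  \<comment> \<open>Below level \<open>k\<close>, horizon two would put \<open>y\<close> under both
    \<open>u\<close> and \<open>v\<close>, hence \<open>r y\<close> under both; but
    \<open>r y\<close> is one of these two incomparable points.\<close>
  have at_k: "lev y = k" if y: "y \<in> A" "lev y \<le> k" "r y \<in> {u, v}" for y
  proof (rule ccontr)
    assume "lev y \<noteq> k"
    then have "lt le y u" "lt le y v" using far uvA y lev_uv k by simp_all
    then have "le (r y) u" "le (r y) v" using rmono[OF y(1) uvA(1)] rmono[OF y(1) uvA(2)] fix_uv by auto
    then show False using y(3) inc by auto
  qed
  \<comment> \<open>In these two facts only the condition on \<open>r\<close> above, respectively
    below, the cut is left open; its failure supplies a bad point.\<close>
  note ups = up_split_exists[OF hz r(1) a kh low top, unfolded uv]
  note downs = down_split_exists[OF hz r(1) a kh low top, unfolded uv]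
  show ?thesis
  proof (cases "lev v = lev u")
    case False
    then have v2: "lev v = k + 2" using near lev_uv k by simp
    have "r y \<notin> {u, v}" if y: "y \<in> A" "lev y \<le> k" for y
    proof
      assume ry: "r y \<in> {u, v}"
      have yk: "lev y = k" using at_k[OF y ry] .
      then have "lt le y v" using far y uvA v2 by simp
      then have "le (r y) v" using rmono[OF y(1) uvA(2)] fix_uv by simp
      then have ryv: "r y = v" using ry inc by auto
      \<comment> \<open>The point is lifted to the level of \<open>u\<close>, because common upper
        bounds are available for two points on the same level.\<close>
      obtain y' where y': "y' \<in> A" "lt le y y'" "lev y' = Suc k"
        using upper_cover[OF y(1)] yk kh by auto
      have "le v (r y')" using rmono[OF y(1) y'(1,2)] ryv by simp
      then have ry': "r y' = v" using above[OF y'(1)] by simp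
      \<comment> \<open>That \<open>v\<close> lies on level \<open>k + 2\<close> shows that the
        level of \<open>u\<close> is not the topmost one, as a common upper bound requires.\<close>
      have "lev u < height A le" using v2 k lev_le[OF uvA(2)] by simp
      then obtain w where w: "w \<in> A" "lt le u w" "lt le y' w"
        using common_upper[OF uvA(1) y'(1)] y'(3) k by auto
      have "le u (r w)" "le v (r w)"
        using rmono[OF uvA(1) w(1,2)] rmono[OF y'(1) w(1,3)] fix_uv ry' by auto
      then show False using above[OF w(1), of u] above[OF w(1), of v] inc by auto
    qed
    then show ?thesis using downs by blast
  next
    case True
    show ?thesis
    proof (rule ccontr)
      assume no: "\<not> (?up \<or> ?down)"
      then obtain x where x: "x \<in> A" "k < lev x" "r x \<notin> {u, v}" using ups by blast
      obtain y where y: "y \<in> A" "lev y \<le> k" "r y \<in> {u, v}" using no downs by blast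
      have yk: "lev y = k" using at_k[OF y] .
      have nA: "a n b \<in> A" for b using aA by simp
      obtain b where b: "\<not> le (a n b) (r x)" using below[OF x(1,3)] by blast
      \<comment> \<open>The stack point \<open>a n b\<close> is fixed by \<open>r\<close>, so
        monotonicity keeps it from being below \<open>x\<close>. Horizon two then leaves only
        adjacent levels for the two.\<close>
      have "\<not> lt le (a n b) x"
        using b rmono[OF nA[of b] x(1)] rid[OF aR[of n b]] by auto
      then have "\<not> lev (a n b) + 2 \<le> lev x" using far[OF nA x(1)] by blast
      then have pk: "lev (a n b) = k" and xk: "lev x = Suc k" using low[of n b] x(2) by auto
      have "\<not> le (r y) (r x)" using above[OF x(1) y(3)] y(3) x(3) by auto
      then have nyx: "\<not> lt le y x" using rmono[OF y(1) x(1)] by blast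
      have "y = a n b"
      proof (rule horizon_two_crown[OF hz, where u = u and v = v and x = x])
        show "x \<noteq> u" "x \<noteq> v" using x(3) fix_uv by auto
      qed (use nA uvA x(1) y(1) pk yk k True xk inc low_lt[of n b] low_lt'[of n b] nyx in auto)
      then have "r y = a n b" using rid[OF aR[of n b]] by simp
      moreover have "a n b \<noteq> u" "a n b \<noteq> v" using low_lt[of n b] low_lt'[of n b] unfolding lt_def by auto
      ultimately show False using y(3) by simp
    qed
  qed
qed

lemma crown_stack_retract_iff_splits:
  assumes hz: "horizon_two A le lev"
  shows "has_crown_stack_retract A le \<longleftrightarrow>
    ((\<exists>k U s t. retractive_up_split A le k U s t \<and>
        (let S = s ` (levels A le 0 k - U);
             B = levels A le (Suc k) (height A le);
             T = t ` B
         in set_lt le (level S le (height S le)) (level T le 0)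
            \<and> (\<forall>u\<in>U. \<exists>v\<in>level T le 0. \<forall>p\<in>{p\<in>B. t p = v}. \<not> lt le u p)))
     \<or> (\<exists>k D s t. retractive_down_split A le k D s t \<and>
        (let S = s ` (levels A le k (height A le) - D);
             B = levels A le 0 (k - 1);
             T = t ` B
         in set_lt le (level T le (height T le)) (level S le 0)
            \<and> (\<forall>d\<in>D. \<exists>v\<in>level T le (height T le). \<forall>p\<in>{p\<in>B. t p = v}. \<not> lt le p d))))"
    (is "_ \<longleftrightarrow> ?splits")
proof
  assume "has_crown_stack_retract A le"
  then show ?splits by (rule crown_stack_retract_splits[OF hz])
next
  assume ?splits
  then show "has_crown_stack_retract A le"
    unfolding Let_def
    by (elim disjE exE conjE)
      (erule up_split_imp[OF hz _ refl refl refl], assumption+,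
       erule down_split_imp[OF hz _ refl refl refl], assumption+)
qed

section \<open>Nice sections of width three\<close>

text \<open>Shifting three times is the identity, so the implications close up to cycles of
  equivalences: \<open>E i j\<close> depends only on the difference of \<open>j\<close> and
  \<open>i\<close> modulo 3.\<close>

lemma cyclic_relation_cases:
  fixes E :: "nat \<Rightarrow> nat \<Rightarrow> bool"
  assumes "\<And>i j. i < 3 \<Longrightarrow> j < 3 \<Longrightarrow> E i j \<Longrightarrow> E ((i + 1) mod 3) ((j + 1) mod 3)"
  shows "E 0 0 = E 1 1" "E 1 1 = E 2 2" "E 0 1 = E 1 2" "E 1 2 = E 2 0" "E 0 2 = E 1 0" "E 1 0 = E 2 1"
  using assms[of 0 0] assms[of 1 1] assms[of 2 2] assms[of 0 1] assms[of 1 2] assms[of 2 0]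
    assms[of 0 2] assms[of 1 0] assms[of 2 1] by (auto simp: numeral_2_eq_2)

lemma less_3_cases: "(i::nat) < 3 \<Longrightarrow> i = 0 \<or> i = 1 \<or> i = 2"
  by auto

text \<open>Of the three differences modulo 3, zero occurs by \<open>refl\<close>, a second one
  occurs because \<open>p\<close> has two upper neighbours, and the third is excluded by
  \<open>notall\<close>. So each upper point misses exactly one lower point, and for
  \<open>x\<close> this is \<open>p\<close>.\<close>

lemma cyclic_relation_crown:
  fixes E :: "nat \<Rightarrow> nat \<Rightarrow> bool"
  assumes cyc: "\<And>i j. i < 3 \<Longrightarrow> j < 3 \<Longrightarrow> E i j \<Longrightarrow> E ((i + 1) mod 3) ((j + 1) mod 3)"
    and refl: "E 0 0" and notall: "\<not> (\<forall>i<3. \<forall>j<3. E i j)"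
    and lt: "p < 3" "y < 3" "u < 3" "v < 3" "x < 3"
    and "u \<noteq> v" "E p u" "E p v" "x \<noteq> u" "x \<noteq> v" "\<not> E y x"
  shows "y = p"
proof -
  note c = cyclic_relation_cases[of E, OF cyc]
  have two: "\<not> (E 0 1 \<and> E 0 2)"
  proof
    assume "E 0 1 \<and> E 0 2"
    then have "E i j" if "i < 3" "j < 3" for i j
      using less_3_cases[OF that(1)] less_3_cases[OF that(2)] c refl by auto
    then show False using notall by blast
  qed
  have "E 0 1 \<or> E 0 2"
    using less_3_cases[OF lt(1)] less_3_cases[OF lt(3)] less_3_cases[OF lt(4)] assms(9-11) c
    by (elim disjE) simp_all
  \<comment> \<open>The points \<open>u\<close>, \<open>v\<close>, \<open>x\<close> are all three
    columns, so a relation to \<open>x\<close> would fill the row of \<open>p\<close> and with it,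
    by cyclic symmetry, all rows.\<close>
  moreover have "\<not> E p x"
  proof
    assume "E p x"
    then have "\<forall>j\<in>{u, v, x}. E p j" using assms(10,11) by simp
    moreover have "{u, v, x} = {..<3}"
      by (rule card_subset_eq) (use lt(3-5) assms(9,12,13) in auto)
    ultimately have "E p 0" "E p 1" "E p 2" by simp_all
    then show False using less_3_cases[OF lt(1)] two c by (elim disjE) simp_all
  qed
  ultimately show ?thesis
    using less_3_cases[OF lt(1)] less_3_cases[OF lt(2)] less_3_cases[OF lt(5)] assms(14) refl c
    by (elim disjE) simp_all
qed

text \<open>At least two of the three differences occur, so each row covers at least two of three
  columns, and two such rows overlap.\<close>

lemma cyclic_relation_common_upper:
  fixes E :: "nat \<Rightarrow> nat \<Rightarrow> bool"
  assumes cyc: "\<And>i j. i < 3 \<Longrightarrow> j < 3 \<Longrightarrow> E i j \<Longrightarrow> E ((i + 1) mod 3) ((j + 1) mod 3)"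
    and refl: "E 0 0" and more: "j < 3" "j \<noteq> 0" "E 0 j" and lt: "x < 3" "y < 3"
  shows "\<exists>w<3. E x w \<and> E y w"
proof -
  note c = cyclic_relation_cases[of E, OF cyc]
  have "E 0 1 \<or> E 0 2" using less_3_cases[OF more(1)] more by auto
  then have "E x 0 \<and> E y 0 \<or> E x 1 \<and> E y 1 \<or> E x 2 \<and> E y 2"
    using less_3_cases[OF lt(1)] less_3_cases[OF lt(2)] refl c by (elim disjE) simp_all
  then show ?thesis by (elim disjE) (rule exI[of _ 0], simp, rule exI[of _ 1], simp, rule exI[of _ 2], simp)
qed

text \<open>The row index of the coordinates \<open>c\<close> serves as \<open>lev\<close>; the main
  task is to identify rows with the level sets obtained by removing minimal points
  repeatedly.\<close>

lemma N2_horizon_two: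
  assumes "N2 A le"
  obtains lev where "horizon_two A le lev"
proof -
  define n where "n = height A le"
  have po: "poset_on A le" and sec: "section_w3 A le" and nice: "nice A le"
    and hor: "horizon A le = 2"
    using assms unfolding N2_def n_def by auto
  obtain c :: "nat \<Rightarrow> nat \<Rightarrow> 'a" where
    inj: "inj_on (\<lambda>(k,j). c k j) ({0..n} \<times> {0..<3})"
    and A: "A = (\<lambda>(k,j). c k j) ` ({0..n} \<times> {0..<3})"
    and step: "\<forall>j<3. \<forall>k<n. lt le (c k j) (c (Suc k) j)"
    and anti: "\<forall>k\<le>n. is_antichain le {c k 0, c k 1, c k 2}"
    and shift: "\<forall>k\<le>n. \<forall>l\<le>n. \<forall>i<3. \<forall>j<3.
          lt le (c k i) (c l j) \<longrightarrow> lt le (c k ((i+1) mod 3)) (c l ((j+1) mod 3))"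
    and n33: "\<forall>k<n. \<not> type33 le (level A le k \<union> level A le (Suc k))"
    using sec unfolding section_w3_def n_def[symmetric]
    by (elim conjE exE) (rule that, assumption+)
  have cA: "c k j \<in> A" if "k \<le> n" "j < 3" for k j
    unfolding A by (rule image_eqI[of _ _ "(k, j)"]) (use that in auto)
  have A_cases: "\<exists>k j. k \<le> n \<and> j < 3 \<and> x = c k j" if x: "x \<in> A" for x
  proof -
    obtain q where "q \<in> {0..n} \<times> {0..<3}" "x = (case q of (k, j) \<Rightarrow> c k j)"
      using x unfolding A by (rule imageE)
    then show ?thesis by (intro exI[of _ "fst q"] exI[of _ "snd q"]) (auto split: prod.splits)
  qed
  have ceq: "k = l \<and> i = j" if "c k i = c l j" "k \<le> n" "l \<le> n" "i < 3" "j < 3" for k l i j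
    using inj_onD[OF inj, of "(k,i)" "(l,j)"] that by simp
  have trans: "lt le x z" if "lt le x y" "lt le y z" "x \<in> A" "y \<in> A" "z \<in> A" for x y z
    using po that unfolding poset_on_def lt_def by metis
  have same_level: "\<not> lt le (c k i) (c k j)" if "k \<le> n" "i < 3" "j < 3" for k i j
  proof -
    have "c k i \<in> {c k 0, c k 1, c k 2}" "c k j \<in> {c k 0, c k 1, c k 2}"
      using less_3_cases[OF that(2)] less_3_cases[OF that(3)] by auto
    then show ?thesis using anti that(1) unfolding is_antichain_def lt_def by blast
  qed
  have chain: "lt le (c k j) (c l j)" if "k < l" "l \<le> n" "j < 3" for k l j
    using that
  proof (induction l)
    case (Suc l)
    have last: "lt le (c l j) (c (Suc l) j)" using step Suc.prems by simp
    show ?case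
    proof (cases "k = l")
      case False
      then have "lt le (c k j) (c l j)" using Suc by simp
      then show ?thesis by (rule trans[OF _ last]) (use cA Suc.prems in simp_all)
    qed (use last in simp)
  qed simp
  \<comment> \<open>If the row did not increase, following the chain of column \<open>j\<close>
    upwards from \<open>c l j\<close> would produce a comparability inside row \<open>k\<close>,
    which is an antichain.\<close>
  have up: "k < l" if kl: "lt le (c k i) (c l j)" "k \<le> n" "l \<le> n" "i < 3" "j < 3" for k l i j
  proof (rule ccontr)
    assume "\<not> k < l"
    then consider "k = l" | "l < k" by linarith
    then show False
    proof cases
      case 1
      then show ?thesis using same_level kl by blast
    next
      case 2
      have "lt le (c k i) (c k j)"
        by (rule trans[OF kl(1) chain[OF 2 kl(2,5)]]) (use cA kl in simp_all)
      then show ?thesis using same_level kl by blast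
    qed
  qed
  define lev where "lev x = fst (inv_into ({0..n} \<times> {0..<3}) (\<lambda>(k,j). c k j) x)" for x
  have lev_c: "lev (c k j) = k" if "k \<le> n" "j < 3" for k j
    using inv_into_f_f[OF inj, of "(k,j)"] that unfolding lev_def by simp
  have lev_cases: "lev x \<le> n \<and> (\<exists>j<3. c (lev x) j = x)" if x: "x \<in> A" for x
  proof -
    obtain k j where "k \<le> n" "j < 3" "x = c k j" using A_cases[OF x] by blast
    then show ?thesis by (intro conjI exI[of _ j]) (simp_all add: lev_c)
  qed
  have lev_mono: "lev x < lev y" if xy: "x \<in> A" "y \<in> A" "lt le x y" for x y
  proof -
    obtain i where i: "i < 3" "c (lev x) i = x" using lev_cases[OF xy(1)] by blast
    obtain j where j: "j < 3" "c (lev y) j = y" using lev_cases[OF xy(2)] by blast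
    show ?thesis
      using up[of "lev x" i "lev y" j] lev_cases[OF xy(1)] lev_cases[OF xy(2)] xy(3) i j by simp
  qed
  \<comment> \<open>A point in a row above \<open>k\<close> is not minimal, since the point of its
    own column in row \<open>k\<close> lies below it.\<close>
  have mins: "minimals le {x\<in>A. k \<le> lev x} = {x\<in>A. lev x = k}" for k
  proof (intro set_eqI iffI)
    fix x assume x: "x \<in> minimals le {x\<in>A. k \<le> lev x}"
    then have xA: "x \<in> A" and kx: "k \<le> lev x" unfolding minimals_def by auto
    obtain j where j: "j < 3" "c (lev x) j = x" using lev_cases[OF xA] by blast
    have ln: "lev x \<le> n" using lev_cases[OF xA] by blast
    have "\<not> k < lev x"
    proof
      assume "k < lev x"
      then have "lt le (c k j) x" "c k j \<in> A" "lev (c k j) = k"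
        using chain[of k "lev x" j] j ln cA lev_c by auto
      then show False using x unfolding minimals_def by auto
    qed
    then show "x \<in> {x\<in>A. lev x = k}" using xA kx by simp
  next
    fix x assume "x \<in> {x\<in>A. lev x = k}"
    then have x: "x \<in> A" "lev x = k" by auto
    then have "\<not> lt le y x" if "y \<in> A" "k \<le> lev y" for y using lev_mono[of y x] that by auto
    then show "x \<in> minimals le {x\<in>A. k \<le> lev x}" using x unfolding minimals_def by auto
  qed
  have rest: "rest A le k = {x\<in>A. k \<le> lev x}" for k
  proof (induction k)
    case (Suc k)
    have "rest A le (Suc k) = {x\<in>A. k \<le> lev x} - {x\<in>A. lev x = k}"
      by (simp only: rest.simps Suc mins)
    also have "\<dots> = {x\<in>A. Suc k \<le> lev x}" by (intro set_eqI) (simp, linarith)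
    finally show ?case .
  qed simp
  have level: "level A le k = {x\<in>A. lev x = k}" for k
    unfolding level_def rest mins ..
  \<comment> \<open>The defining property of the horizon holds vacuously at \<open>n + 1\<close>, so the LEAST is attained.\<close>
  have "\<forall>k. k + 2 \<le> n \<longrightarrow> set_lt le (level A le k) (level A le (k + 2))"
    using LeastI[of "\<lambda>\<eta>. \<forall>k. k + \<eta> \<le> n \<longrightarrow> set_lt le (level A le k) (level A le (k + \<eta>))" "Suc n"] hor
    unfolding horizon_def n_def[symmetric] by simp
  then have hor2: "lt le x y" if "x \<in> A" "y \<in> A" "lev y = lev x + 2" for x y
    using that lev_cases[of y] unfolding set_lt_def level by auto
  have far: "lt le x y" if xy: "x \<in> A" "y \<in> A" "lev x + 2 \<le> lev y" for x y
  proof -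
    obtain j where j: "j < 3" "c (lev y) j = y" using lev_cases[OF xy(2)] by blast
    have ln: "lev y \<le> n" using lev_cases[OF xy(2)] by blast
    \<comment> \<open>The horizon settles a distance of exactly two; larger distances are bridged by
      the point of the column of \<open>y\<close> two rows above \<open>x\<close>.\<close>
    let ?z = "c (lev x + 2) j"
    have z: "?z \<in> A" "lev ?z = lev x + 2" using cA lev_c j ln xy(3) by auto
    then have xz: "lt le x ?z" using hor2 xy(1) by blast
    show ?thesis
    proof (cases "lev x + 2 = lev y")
      case False
      then have "lt le ?z y" using chain[of "lev x + 2" "lev y" j] j ln xy(3) by simp
      then show ?thesis by (rule trans[OF xz]) (use xy z in simp_all)
    qed (use hor2 xy in simp)
  qed
  have notall: "\<not> (\<forall>i<3. \<forall>j<3. lt le (c k i) (c (Suc k) j))" if k: "k < n" for k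
  proof
    assume all: "\<forall>i<3. \<forall>j<3. lt le (c k i) (c (Suc k) j)"
    have lvl: "level A le l = {c l 0, c l 1, c l 2}" if l: "l \<le> n" for l
    proof (intro set_eqI iffI)
      fix x assume "x \<in> level A le l"
      then have "x \<in> A" "lev x = l" unfolding level by auto
      then obtain j where "j < 3" "c l j = x" using lev_cases by blast
      then show "x \<in> {c l 0, c l 1, c l 2}" using less_3_cases by auto
    qed (use cA lev_c l in \<open>auto simp: level\<close>)
    have dist: "c l i \<noteq> c l' j" if "l \<noteq> l' \<or> i \<noteq> j" "l \<le> n" "l' \<le> n" "i < 3" "j < 3" for l l' i j
      using ceq that by blast
    have "type33 le (level A le k \<union> level A le (Suc k))"
      unfolding type33_def
    proof (rule exI[of _ "c k 0"], rule exI[of _ "c k 1"], rule exI[of _ "c k 2"],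
        rule exI[of _ "c (Suc k) 0"], rule exI[of _ "c (Suc k) 1"], rule exI[of _ "c (Suc k) 2"],
        intro conjI)
      show "level A le k \<union> level A le (Suc k)
        = {c k 0, c k 1, c k 2, c (Suc k) 0, c (Suc k) 1, c (Suc k) 2}"
        using lvl[of k] lvl[of "Suc k"] k by auto
      show "distinct [c k 0, c k 1, c k 2, c (Suc k) 0, c (Suc k) 1, c (Suc k) 2]"
        using k by (simp add: dist)
      show "set_lt le {c k 0, c k 1, c k 2} {c (Suc k) 0, c (Suc k) 1, c (Suc k) 2}"
        using all unfolding set_lt_def by simp
    qed (use anti k in auto)
    then show False using n33 k by blast
  qed
  have cyc: "lt le (c k ((i + 1) mod 3)) (c (Suc k) ((j + 1) mod 3))"
    if "k < n" "i < 3" "j < 3" "lt le (c k i) (c (Suc k) j)" for k i j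
    using shift that by simp
  have "horizon_two A le lev"
    unfolding horizon_two_def
  proof (intro conjI allI ballI impI)
    show "poset_on A le" by (fact po)
    show "levels A le i j = {x\<in>A. i \<le> lev x \<and> lev x \<le> j}" for i j
      unfolding levels_def level by auto
    show "lev x \<le> height A le" if "x \<in> A" for x using lev_cases[OF that] unfolding n_def by blast
    show "lev x < lev y" if "x \<in> A" "y \<in> A" "lt le x y" for x y using lev_mono that .
    show "lt le x y" if "x \<in> A" "y \<in> A" "lev x + 2 \<le> lev y" for x y using far that .
    show "\<exists>y\<in>A. lt le x y \<and> lev y = Suc (lev x)" if x: "x \<in> A" "lev x < height A le" for x
    proof -
      obtain j where j: "j < 3" "c (lev x) j = x" using lev_cases[OF x(1)] by blast
      have ln: "lev x < n" using x(2) unfolding n_def .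
      then have "lt le x (c (Suc (lev x)) j)" using step j by metis
      moreover have "c (Suc (lev x)) j \<in> A" "lev (c (Suc (lev x)) j) = Suc (lev x)"
        using cA lev_c j(1) ln by simp_all
      ultimately show ?thesis by blast
    qed
    show "y = p" if in_A: "p \<in> A" "y \<in> A" "u \<in> A" "v \<in> A" "x \<in> A"
      and eqs: "lev p = lev y" "lev u = Suc (lev p)" "lev v = lev u" "lev x = lev u"
      and rel: "u \<noteq> v" "lt le p u" "lt le p v" "x \<noteq> u" "x \<noteq> v" "\<not> lt le y x" for p y u v x
    proof -
      define k where "k = lev p"
      have ex: "\<exists>j<3. c (lev w) j = w" if "w \<in> A" for w using lev_cases[OF that] by blast
      obtain ip where ip: "ip < 3" "c k ip = p" using ex[of p] in_A k_def by auto
      obtain iy where iy: "iy < 3" "c k iy = y" using ex[of y] in_A k_def eqs by auto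
      obtain iu where iu: "iu < 3" "c (Suc k) iu = u" using ex[of u] in_A k_def eqs by auto
      obtain iv where iv: "iv < 3" "c (Suc k) iv = v" using ex[of v] in_A k_def eqs by auto
      obtain ix where ix: "ix < 3" "c (Suc k) ix = x" using ex[of x] in_A k_def eqs by auto
      have k: "k < n" using lev_cases[of u] in_A eqs k_def by auto
      have "iy = ip"
      proof (rule cyclic_relation_crown[of "\<lambda>i j. lt le (c k i) (c (Suc k) j)" ip iy iu iv ix])
        show "lt le (c k 0) (c (Suc k) 0)" using step k by simp
      qed (use cyc[OF k] notall[OF k] rel ip iy iu iv ix in auto)
      then show ?thesis using ip iy by simp
    qed
    show "\<exists>w\<in>A. lt le x w \<and> lt le y w"
      if xy: "x \<in> A" "y \<in> A" "lev x = lev y" "lev x < height A le" for x y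
    proof -
      define k where "k = lev x"
      have k: "k < n" using xy(4) unfolding k_def n_def .
      show ?thesis
      proof (cases "k + 2 \<le> n")
        \<comment> \<open>Any point two levels up is above both.\<close>
        case True
        then have w: "c (k + 2) 0 \<in> A" "lev (c (k + 2) 0) = k + 2" using cA lev_c by simp_all
        show ?thesis
          using far[OF xy(1) w(1)] far[OF xy(2) w(1)] xy(3) k_def w by (intro bexI[OF _ w(1)]) simp
      next
        case False
        \<comment> \<open>Niceness rules out type 3C for the two topmost levels.\<close>
        then have nk: "n = Suc k" using k by simp
        have c0: "c k 0 \<in> A" "c n 0 \<in> A" "lt le (c k 0) (c n 0)"
          using cA k step nk by simp_all
        then have "\<not> {z\<in>A. lt le (c k 0) z} \<subseteq> {z\<in>A. le (c n 0) z}"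
          using nice unfolding nice_def by blast
        then obtain z where z: "z \<in> A" "lt le (c k 0) z" "\<not> le (c n 0) z" by blast
        have "k < lev z" using lev_mono[OF c0(1) z(1,2)] lev_c[of k 0] k by simp
        then have "lev z = n" using lev_cases[OF z(1)] nk by simp
        then obtain j where j: "j < 3" "c n j = z" using lev_cases[OF z(1)] by auto
        have "le (c n 0) (c n 0)" using c0(2) po unfolding poset_on_def by blast
        then have "j \<noteq> 0" using z(3) j(2) by metis
        obtain ix where ix: "ix < 3" "c k ix = x" using lev_cases[OF xy(1)] k_def by auto
        obtain iy where iy: "iy < 3" "c k iy = y" using lev_cases[OF xy(2)] k_def xy(3) by auto
        have "\<exists>w<3. lt le (c k ix) (c (Suc k) w) \<and> lt le (c k iy) (c (Suc k) w)"
        proof (rule cyclic_relation_common_upper[where j = j])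
          show "lt le (c k 0) (c (Suc k) 0)" using step k by simp
          show "lt le (c k 0) (c (Suc k) j)" using z(2) j(2) nk by simp
        qed (use cyc[OF k] j ix iy \<open>j \<noteq> 0\<close> in auto)
        then show ?thesis using cA nk ix iy by blast
      qed
    qed
  qed
  then show thesis using that by blast
qed

theorem theorem6p2:
  fixes A :: "'a set" and le :: "'a \<Rightarrow> 'a \<Rightarrow> bool"
  assumes "N2 A le"
  shows "has_crown_stack_retract A le \<longleftrightarrow>
    ((\<exists>k U s t. retractive_up_split A le k U s t \<and>
        (let S = s ` (levels A le 0 k - U);
             B = levels A le (Suc k) (height A le);
             T = t ` B
         in set_lt le (level S le (height S le)) (level T le 0)
            \<and> (\<forall>u\<in>U. \<exists>v\<in>level T le 0. \<forall>p\<in>{p\<in>B. t p = v}. \<not> lt le u p)))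
     \<or> (\<exists>k D s t. retractive_down_split A le k D s t \<and>
        (let S = s ` (levels A le k (height A le) - D);
             B = levels A le 0 (k - 1);
             T = t ` B
         in set_lt le (level T le (height T le)) (level S le 0)
            \<and> (\<forall>d\<in>D. \<exists>v\<in>level T le (height T le). \<forall>p\<in>{p\<in>B. t p = v}. \<not> lt le p d))))"
  by (rule N2_horizon_two[OF assms], rule crown_stack_retract_iff_splits)

end
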